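(* Let the constraints, the maximum entropy vector $\varphi^{\ast}\in\mathbb{R}^m$, $H^{\ast}$, $\mu^{\ast}$, $\varphi^{\ast}_{\min}$, $\mathcal{C}(\delta)$ and $\vartheta_{\infty}$ be as in the context. Given any $\delta=(\delta^{=},\delta^{\leqslant},\delta^{=0},\delta^{\leqslant 0})$ with positive entries, any $\varepsilon>0$ and any $\eta>0$, define for $\alpha\in(0,1)$ $$C_1=\frac{0.5(m+\mu^{\ast})-1}{(1-\alpha)\eta H^{\ast}},\qquad C_2=\frac{m\ln 0.6+(0.5\ln 2\pi+1/12-0.5\ln\mu^{\ast})\mu^{\ast}+\ln\left(\frac{1/\varepsilon+1}{0.249}\right)}{(1-\alpha)\eta H^{\ast}},$$ $$N(\alpha)=\begin{cases}1.5\,C_1\ln(C_1+C_2)+C_2,&\text{if }C_2>0\text{ and }C_1+C_2\geqslant 21,\\ 1.5\,C_1\ln C_1+C_2,&\text{if }C_2\leqslant 0,\end{cases}$$ $$\vartheta_0(\alpha)=\min\left(\vartheta_{\infty},\ \frac{2}{3}\,\frac{\alpha\eta H^{\ast}}{\ln\left(m/(\alpha\eta H^{\ast})\right)},\ \varphi^{\ast}_{\min}\right),$$ and let $\kappa=2$ if $\mu^{\ast}=m$ and $\kappa=1$ otherwise. Let $\hat\alpha\in(0,1)$ be the solution of the equation $$N(\alpha)=\frac{m-1}{\kappa\,\vartheta_0(\alpha)},$$ and set $$N=N(\hat\alpha)=\frac{m-1}{\kappa}\max\left(\frac{3\ln\left(m/(\hat\alpha\eta H^{\ast})\right)}{2\hat\alpha\eta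 H^{\ast}},\ \frac{1}{\vartheta_{\infty}},\ \frac{1}{\varphi^{\ast}_{\min}}\right).$$ Then for all $n\geqslant N$ with $n\geqslant 100$, $$\frac{\#\{f\in F_n\cap\mathcal{C}(\delta):\ H(f)\geqslant(1-\eta)H^{\ast}\}}{\#\{f\in F_n\cap\mathcal{C}(\delta)\}}\geqslant 1-\varepsilon.$$
   Context: Frequency vectors. Fix a positive integer $m$. For $n\in\mathbb{N}$, $F_n=\{(\nu_1/n,\dots,\nu_m/n):\nu_i\in\mathbb{Z}_{\geqslant 0},\ \nu_1+\dots+\nu_m=n\}$. For $f\in F_n$, $\#f=\binom{n}{nf_1,\dots,nf_m}=n!/\prod_i(nf_i)!$ is its number of realizations (assignments of $n$ balls to $m$ boxes producing $f$); for a set $S\subseteq F_n$, $\#S=\sum_{f\in S}\#f$. $H(x)=-\sum_{i=1}^m x_i\ln x_i$ (with $0\ln 0=0$). Constraints. There are finitely many linear constraints, with real data independent of $n$, in four categories (any may be absent): $A^{=}x=b^{=}$ and $A^{\leqslant}x\leqslant b^{\leqslant}$, where all entries of $b^{=}$ and $b^{\leqslant}$ are non-zero, and $A^{=0}x=0$, $A^{\leqslant 0}x\leqslant 0$. Together with $x_i\geqslant 0$, $\sum_i x_i=1$ they are assumed satisfiable over $\mathbb{R}^m$; $\varphi^{\ast}$ is the unique maximizer of $H$ over the resulting polytope and $H^{\ast}=H(\varphi^{\ast})$. $\mu^{\ast}$ is the number of non-zero entries of $\varphi^{\ast}$ and $\varphi^{\ast}_{\min}$ its smallest non-zero entry. Tolerances.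 For $\delta=(\delta^{=},\delta^{\leqslant},\delta^{=0},\delta^{\leqslant 0})$ with positive entries, $\mathcal{C}(\delta)$ is the set of $x\in\mathbb{R}^m$ such that: $A^{=}x=b^{=}+\beta$ for some $\beta$ with $\|\beta\|_{\infty}\leqslant\delta^{=}|b^{=}|_{\min}$; $A^{\leqslant}x\leqslant b^{\leqslant}+\beta$ for some $\beta$ with $\|\beta\|_{\infty}\leqslant\delta^{\leqslant}|b^{\leqslant}|_{\min}$; $A^{=0}x=\zeta$ for some $\zeta$ with $\|\zeta\|_{\infty}\leqslant\delta^{=0}$; $A^{\leqslant 0}x\leqslant\zeta$ for some $\zeta$ with $\|\zeta\|_{\infty}\leqslant\delta^{\leqslant 0}$. Here $|b|_{\min}$ is the smallest absolute value of an entry of $b$. Finally $$\vartheta_{\infty}=\min\left(\frac{\delta^{=}|b^{=}|_{\min}}{\|A^{=}\|_{\infty}},\frac{\delta^{\leqslant}|b^{\leqslant}|_{\min}}{\|A^{\leqslant}\|_{\infty}},\frac{\delta^{=0}}{\|A^{=0}\|_{\infty}},\frac{\delta^{\leqslant 0}}{\|A^{\leqslant 0}\|_{\infty}}\right),$$ where $\|A\|_{\infty}$ is the matrix norm equal to the maximum of the $\ell_1$ norms of the rows; terms for absent categories are omitted, and $\vartheta_{\infty}=\infty$ (so $1/\vartheta_\infty=0$) if there are no constraints. The case $C_2>0$, $C_1+C_2<21$ is not covered by the definition of $N(\alpha)$ and is assumed not to occur.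
   Formalization: H* > 0 is assumed, since C_1, C_2 and ϑ_0 are otherwise undefined; the equality of N(α̂) with the max formula is claimed only when α̂ηH* < m (it fails or is undefined otherwise), while the concentration bound uses the max formula for every η > 0. *)

theory Defs
  imports "HOL-Analysis.Analysis"
begin

section \<open>Entropy and frequency vectors\<close>

text \<open>The term for a zero entry vanishes, so 0 ln 0 = 0 as required.\<close>

definition entropy :: "real^'m::finite \<Rightarrow> real" where
  "entropy x = - (\<Sum>i\<in>UNIV. x $ i * ln (x $ i))"

definition freqs :: "nat \<Rightarrow> (real^'m::finite) set" where
  "freqs n = {f. \<exists>\<nu> :: 'm \<Rightarrow> nat. (\<Sum>i\<in>UNIV. \<nu> i) = n \<and> (\<forall>i. f $ i = real (\<nu> i) / real n)}"

text \<open>The multinomial coefficient; for \<open>f \<in> freqs n\<close> the numbers \<open>n f\<^sub>i\<close> are natural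
  numbers, so that the rounding is exact.\<close>

definition num_realizations :: "nat \<Rightarrow> real^'m::finite \<Rightarrow> real" where
  "num_realizations n f = fact n / (\<Prod>i\<in>UNIV. fact (nat \<lfloor>real n * f $ i\<rfloor>))"

definition num_realizations_set :: "nat \<Rightarrow> (real^'m::finite) set \<Rightarrow> real" where
  "num_realizations_set n S = (\<Sum>f\<in>S. num_realizations n f)"


section \<open>Constraints\<close>

text \<open>A matrix with \<open>CARD('m)\<close> columns is the list of its rows, because the number of rows may be
  zero (absent category).\<close>

definition mat_vec :: "(real^'m::finite) list \<Rightarrow> real^'m \<Rightarrow> real list" where
  "mat_vec A x = map (\<lambda>a. a \<bullet> x) A"

definition vec_add :: "real list \<Rightarrow> real list \<Rightarrow> real list" where
  "vec_add u v = map2 (+) u v"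

definition vec_le :: "real list \<Rightarrow> real list \<Rightarrow> bool" where
  "vec_le u v \<longleftrightarrow> list_all2 (\<le>) u v"

text \<open>\<open>linf_le v c\<close> says that the maximum norm of \<open>v\<close> is at most \<open>c\<close>.
  It holds for the empty vector, whatever \<open>c\<close> is.\<close>

definition linf_le :: "real list \<Rightarrow> real \<Rightarrow> bool" where
  "linf_le v c \<longleftrightarrow> (\<forall>t\<in>set v. \<bar>t\<bar> \<le> c)"

text \<open>The next two are meaningful for nonempty lists only.\<close>

definition abs_min :: "real list \<Rightarrow> real" where
  "abs_min b = Min (abs ` set b)"

definition mat_norm_inf :: "(real^'m::finite) list \<Rightarrow> real" where
  "mat_norm_inf A = Max ((\<lambda>a. \<Sum>i\<in>UNIV. \<bar>a $ i\<bar>) ` set A)"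

record ('m::finite) constraints =
  Aeq :: "(real^'m) list"
  beq :: "real list"
  Ale :: "(real^'m) list"
  ble :: "real list"
  Aeq0 :: "(real^'m) list"
  Ale0 :: "(real^'m) list"

definition wf_constraints :: "('m::finite) constraints \<Rightarrow> bool" where
  "wf_constraints K \<longleftrightarrow>
     length (beq K) = length (Aeq K) \<and> length (ble K) = length (Ale K) \<and>
     0 \<notin> set (beq K) \<and> 0 \<notin> set (ble K)"

definition prob_simplex :: "(real^'m::finite) set" where
  "prob_simplex = {x. (\<forall>i. x $ i \<ge> 0) \<and> (\<Sum>i\<in>UNIV. x $ i) = 1}"

definition polytope_of :: "('m::finite) constraints \<Rightarrow> (real^'m) set" where
  "polytope_of K = {x \<in> prob_simplex.
     mat_vec (Aeq K) x = beq K \<and>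
     vec_le (mat_vec (Ale K) x) (ble K) \<and>
     mat_vec (Aeq0 K) x = replicate (length (Aeq0 K)) 0 \<and>
     vec_le (mat_vec (Ale0 K) x) (replicate (length (Ale0 K)) 0)}"

record tolerances =
  tol_eq :: real
  tol_le :: real
  tol_eq0 :: real
  tol_le0 :: real

definition pos_tolerances :: "tolerances \<Rightarrow> bool" where
  "pos_tolerances d \<longleftrightarrow> tol_eq d > 0 \<and> tol_le d > 0 \<and> tol_eq0 d > 0 \<and> tol_le0 d > 0"

definition relaxed :: "('m::finite) constraints \<Rightarrow> tolerances \<Rightarrow> (real^'m) set" where
  "relaxed K d = {x.
     (\<exists>\<beta>. length \<beta> = length (beq K) \<and> linf_le \<beta> (tol_eq d * abs_min (beq K)) \<and>
          mat_vec (Aeq K) x = vec_add (beq K) \<beta>) \<and>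
     (\<exists>\<beta>. length \<beta> = length (ble K) \<and> linf_le \<beta> (tol_le d * abs_min (ble K)) \<and>
          vec_le (mat_vec (Ale K) x) (vec_add (ble K) \<beta>)) \<and>
     (\<exists>\<zeta>. linf_le \<zeta> (tol_eq0 d) \<and> mat_vec (Aeq0 K) x = \<zeta>) \<and>
     (\<exists>\<zeta>. linf_le \<zeta> (tol_le0 d) \<and> vec_le (mat_vec (Ale0 K) x) \<zeta>)}"

text \<open>Division is that of the extended reals: a positive number divided by 0 is \<open>\<infinity>\<close>, which is the
  right value for a zero matrix. An absent category does not contribute to the minimum.\<close>

definition tol_ratio :: "real \<Rightarrow> (real^'m::finite) list \<Rightarrow> ereal" where
  "tol_ratio c A = (if A = [] then \<infinity> else ereal c / ereal (mat_norm_inf A))"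

definition theta_inf :: "('m::finite) constraints \<Rightarrow> tolerances \<Rightarrow> ereal" where
  "theta_inf K d = Min {tol_ratio (tol_eq d * abs_min (beq K)) (Aeq K),
                        tol_ratio (tol_le d * abs_min (ble K)) (Ale K),
                        tol_ratio (tol_eq0 d) (Aeq0 K),
                        tol_ratio (tol_le0 d) (Ale0 K)}"


section \<open>The quantities in the concentration theorem\<close>

text \<open>In this section \<open>\<phi>\<close> stands for the maximum entropy vector.\<close>

definition num_nonzero :: "real^'m::finite \<Rightarrow> nat" where
  "num_nonzero \<phi> = card {i. \<phi> $ i \<noteq> 0}"

definition min_nonzero :: "real^'m::finite \<Rightarrow> real" where
  "min_nonzero \<phi> = Min {\<phi> $ i | i. \<phi> $ i \<noteq> 0}"

definition C1 :: "real^'m::finite \<Rightarrow> real \<Rightarrow> real \<Rightarrow> real" where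
  "C1 \<phi> \<eta> \<alpha> = (0.5 * (real CARD('m) + real (num_nonzero \<phi>)) - 1) / ((1 - \<alpha>) * \<eta> * entropy \<phi>)"

definition C2 :: "real^'m::finite \<Rightarrow> real \<Rightarrow> real \<Rightarrow> real \<Rightarrow> real" where
  "C2 \<phi> \<epsilon> \<eta> \<alpha> =
     (real CARD('m) * ln 0.6
      + (0.5 * ln (2 * pi) + 1 / 12 - 0.5 * ln (real (num_nonzero \<phi>))) * real (num_nonzero \<phi>)
      + ln ((1 / \<epsilon> + 1) / 0.249))
     / ((1 - \<alpha>) * \<eta> * entropy \<phi>)"

definition N_fun :: "real^'m::finite \<Rightarrow> real \<Rightarrow> real \<Rightarrow> real \<Rightarrow> real" where
  "N_fun \<phi> \<epsilon> \<eta> \<alpha> =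
     (let c1 = C1 \<phi> \<eta> \<alpha>; c2 = C2 \<phi> \<epsilon> \<eta> \<alpha> in
      if c2 > 0 \<and> c1 + c2 \<ge> 21 then 1.5 * c1 * ln (c1 + c2) + c2
      else if c2 \<le> 0 then 1.5 * c1 * ln c1 + c2
      else undefined)"

definition theta_0 :: "('m::finite) constraints \<Rightarrow> tolerances \<Rightarrow> real^'m \<Rightarrow> real \<Rightarrow> real \<Rightarrow> ereal" where
  "theta_0 K d \<phi> \<eta> \<alpha> =
     Min {theta_inf K d,
          ereal (2 / 3) * (ereal (\<alpha> * \<eta> * entropy \<phi>)
                           / ereal (ln (real CARD('m) / (\<alpha> * \<eta> * entropy \<phi>)))),
          ereal (min_nonzero \<phi>)}"

definition kappa :: "real^'m::finite \<Rightarrow> real" where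
  "kappa \<phi> = (if num_nonzero \<phi> = CARD('m) then 2 else 1)"

definition N_bound :: "('m::finite) constraints \<Rightarrow> tolerances \<Rightarrow> real^'m \<Rightarrow> real \<Rightarrow> real \<Rightarrow> ereal" where
  "N_bound K d \<phi> \<eta> \<alpha> =
     ereal ((real CARD('m) - 1) / kappa \<phi>) *
     Max {ereal (3 * ln (real CARD('m) / (\<alpha> * \<eta> * entropy \<phi>)) / (2 * \<alpha> * \<eta> * entropy \<phi>)),
          1 / theta_inf K d,
          1 / ereal (min_nonzero \<phi>)}"

end

theory Submission
  imports Defs
begin

text \<open>Vectors of entropy below \<open>(1 - \<eta>) H\<^sup>*\<close> have together at most
  \<open>exp (n (1 - \<eta>) H\<^sup>*) \<cdot> T(n, m)\<close> realizations, where \<open>T(n, m)\<close> is the sum of \<open>#f exp (- n H(f))\<close>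
  over all frequency vectors. Since \<open>T(n, m)\<close> is \<open>n! / n\<^sup>n\<close> times the \<open>n\<close>-th coefficient of \<open>G\<^sup>m\<close>
  for \<open>G = 1 / (1 - tree function)\<close>, and \<open>x G' = G\<^sup>3 - G\<^sup>2\<close>, it satisfies
  \<open>T(n, m + 2) = T(n, m + 1) + (n / m) T(n, m)\<close>, and hence
  \<open>T(n, m) \<le> 9.8 \<cdot> 0.6\<^sup>m n\<^bsup>(m-1)/2\<^esup>\<close> for \<open>n \<ge> 100\<close>. On the other hand, rounding \<open>n \<phi>\<^sup>*\<close> by largest
  remainders gives one frequency vector that meets the relaxed constraints and loses at most
  \<open>\<mu>\<^sup>* ln (4 n) / (4 n) \<le> \<alpha> \<eta> H\<^sup>*\<close> of entropy; Stirling's formula bounds its number of realizations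
  from below, and the definition of \<open>N(\<alpha>)\<close> is what makes this one vector dominate.\<close>

section \<open>The tree function\<close>

text \<open>Write \<open>c0 = (m - 1) / kappa\<close> for the factor in front of the maximum in N.
  The entropy estimate closes only if the rounding loss has the form
  \<open>\<mu> / (4 * n) * ln (4 * n)\<close> with \<open>\<mu> / 4 <= c0\<close>. For m = \<mu> = 2
  both sides are 1/2, so this argument has no slack in the quarter. It is obtained by giving the
  remaining units to the largest fractional parts, and m = 2 gets a rounding of its own, because
  there \<open>c0 < 1\<close> forbids moving an entry by a whole ball. The recurrence for T(n, m) is
  exact and has positive coefficients, so upper bounds propagate through it and only T(n, 1) and
  T(n, 2) need direct estimates; this is what makes the bound uniform in m. The numerator of
  \<open>C1\<close> adds up the powers of n: (m - 1)/2 from T(n, m), -1/2 from Stirling's formula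
  for n!, and \<mu>/2 from the \<mu> factorials in the denominator. The constants 9.8 and 0.249 meet
  in 9.8 * 0.249 <= sqrt (2 pi).\<close>

lemma alternating_binomial_power:
  assumes "n \<ge> 2"
  shows "(\<Sum>k<n. real (n choose k) * (- 1) ^ k * real (n - k) ^ (n - 1)) = 0"
proof -
  let ?E = "fps_exp (1::real)"
  have "(?E - 1) ^ n = (\<Sum>k\<le>n. of_nat (n choose k) * (- 1) ^ k * ?E ^ (n - k))"
    using binomial_ring[of "- 1" ?E n] by simp
  also have "\<dots> = (\<Sum>k\<le>n. fps_const (real (n choose k) * (- 1) ^ k) * fps_exp (real (n - k)))"
  proof (intro sum.cong refl)
    fix k
    have "(- 1 :: real fps) ^ k = fps_const ((- 1) ^ k)"
      by (metis fps_const_1_eq_1 fps_const_neg fps_const_power)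
    then show "of_nat (n choose k) * (- 1) ^ k * ?E ^ (n - k)
      = fps_const (real (n choose k) * (- 1) ^ k) * fps_exp (real (n - k))"
      by (simp add: fps_exp_power_mult fps_of_nat[symmetric])
  qed
  finally have "fps_nth ((?E - 1) ^ n) (n - 1)
    = (\<Sum>k\<le>n. real (n choose k) * (- 1) ^ k * (real (n - k) ^ (n - 1) / fact (n - 1)))"
    by (simp add: fps_sum_nth)
  \<comment> \<open>The series of e^x - 1 has no constant term, so its n-th power has no coefficient
    below n.\<close>
  moreover have "fps_nth ((?E - 1) ^ n) (n - 1) = 0"
    using startsby_zero_power_prefix[of "?E - 1" n] assms by simp
  ultimately have "(\<Sum>k\<le>n. real (n choose k) * (- 1) ^ k * real (n - k) ^ (n - 1)) / fact (n - 1) = 0"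
    by (simp add: sum_divide_distrib)
  \<comment> \<open>Here \<open>n >= 2\<close> matters: for n = 1 the term k = n would be 0 ^ 0 =
    1.\<close>
  moreover have "real (n - n) ^ (n - 1) = 0" using assms by (simp add: power_0_left)
  ultimately show ?thesis
    unfolding lessThan_Suc_atMost[symmetric] sum.lessThan_Suc by (simp only: divide_eq_0_iff fact_nonzero) simp
qed

text \<open>A limiting case of Abel's binomial identity. Both sides have the same derivative in \<open>x\<close> by
  induction, and at \<open>x = - n\<close> the left-hand side is a finite difference of order \<open>n\<close> of a
  polynomial of degree \<open>n - 1\<close>.\<close>

lemma Abel_binomial:
  assumes "n \<ge> 1"
  shows "(\<Sum>k<n. real (n choose k) * (x + real k) ^ k * real (n - k) ^ (n - k - 1))
    = real n * (x + real n) ^ (n - 1)"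
  using assms
proof (induction n arbitrary: x rule: less_induct)
  case (less n)
  show ?case
  proof (cases "n = 1")
    case True
    then show ?thesis by simp
  next
    case False
    then obtain p where p: "n = Suc p" "p \<ge> 1" using less.prems by (cases n) auto
    define D where "D x = (\<Sum>k<n. real (n choose k) * (x + real k) ^ k * real (n - k) ^ (n - k - 1))
      - real n * (x + real n) ^ (n - 1)" for x
    have der: "(D has_real_derivative 0) (at x)" for x
    proof -
      have "(D has_real_derivative
          (\<Sum>k<n. real (n choose k) * (real k * (x + real k) ^ (k - 1)) * real (n - k) ^ (n - k - 1))
          - real n * (real (n - 1) * (x + real n) ^ (n - 1 - 1))) (at x)"
        unfolding D_def by (auto intro!: derivative_eq_intros sum.cong)
      \<comment> \<open>Absorbing the factor k into the binomial coefficient and shifting the index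
        gives the same sum for \<open>p\<close> at \<open>x + 1\<close>; hence the induction
        hypothesis must hold for arbitrary \<open>x\<close>.\<close>
      moreover have "(\<Sum>k<n. real (n choose k) * (real k * (x + real k) ^ (k - 1)) * real (n - k) ^ (n - k - 1))
        = (\<Sum>k<p. real n * (real (p choose k) * (x + 1 + real k) ^ k * real (p - k) ^ (p - k - 1)))"
      proof -
        have "real (Suc p choose Suc k) * real (Suc k) = real (Suc p) * real (p choose k)" for k
          using Suc_times_binomial_eq[of p k] by (metis mult.commute of_nat_mult)
        then have *: "real (Suc p choose Suc k) * (real (Suc k) * y) * z = real (Suc p) * (real (p choose k) * y * z)"
          for k y z by (metis mult.assoc)
        show ?thesis unfolding p(1) sum.lessThan_Suc_shift
          by (simp add: * add_ac del: of_nat_Suc binomial_Suc_Suc)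
             (intro sum.cong, simp_all add: algebra_simps)
      qed
      moreover have "\<dots> = real n * (real p * (x + 1 + real p) ^ (p - 1))"
        unfolding sum_distrib_left[symmetric] using less.IH[of p "x + 1"] p by simp
      ultimately show ?thesis using p by (simp add: add_ac)
    qed
    have "D x = D (- real n)" using DERIV_isconst_all der by blast
    also have "\<dots> = 0"
    proof -
      have "(\<Sum>k<n. real (n choose k) * (- real n + real k) ^ k * real (n - k) ^ (n - k - 1))
        = (\<Sum>k<n. real (n choose k) * (- 1) ^ k * real (n - k) ^ (n - 1))"
      proof (intro sum.cong refl)
        fix k assume "k \<in> {..<n}"
        then have "k < n" by simp
        then have "- real n + real k = (- 1) * real (n - k)" by (simp add: of_nat_diff)
        then have "(- real n + real k) ^ k = (- 1) ^ k * real (n - k) ^ k"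
          by (metis power_mult_distrib)
        moreover have "n - 1 = k + (n - k - 1)" using \<open>k < n\<close> by simp
        then have "real (n - k) ^ (n - 1) = real (n - k) ^ k * real (n - k) ^ (n - k - 1)"
          by (metis power_add)
        ultimately show "real (n choose k) * (- real n + real k) ^ k * real (n - k) ^ (n - k - 1)
          = real (n choose k) * (- 1) ^ k * real (n - k) ^ (n - 1)" by (simp add: mult_ac)
      qed
      then show ?thesis using alternating_binomial_power[of n] p by (simp add: D_def)
    qed
    finally show ?thesis by (simp add: D_def)
  qed
qed

text \<open>\<open>tree_fps\<close> is the solution of \<open>T = x e\<^sup>T\<close>; instead of this equation only
  \<open>pow_fps = 1 / (1 - T)\<close> is used.\<close>

definition tree_fps :: "real fps" where
  "tree_fps = Abs_fps (\<lambda>n. real n ^ (n - 1) / fact n * of_bool (n > 0))"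

definition pow_fps :: "real fps" where
  "pow_fps = Abs_fps (\<lambda>n. real n ^ n / fact n)"

text \<open>For n > 0 the n-th coefficient of the product of the two series, multiplied by n!, is
  the sum in \<open>Abel_binomial\<close> at x = 0.\<close>

lemma pow_fps_tree_fps: "pow_fps * (1 - tree_fps) = 1"
proof (rule fps_ext)
  fix n
  show "fps_nth (pow_fps * (1 - tree_fps)) n = fps_nth 1 n"
  proof (cases "n = 0")
    case True
    then show ?thesis by (simp add: pow_fps_def tree_fps_def)
  next
    case False
    have "fps_nth (pow_fps * tree_fps) n = (\<Sum>k<Suc n. fps_nth pow_fps k * fps_nth tree_fps (n - k))"
      by (simp add: fps_mult_nth lessThan_Suc_atMost atLeast0AtMost)
    also have "\<dots> = (\<Sum>k<n. fps_nth pow_fps k * fps_nth tree_fps (n - k))"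
      by (simp add: tree_fps_def)
    also have "\<dots> = (\<Sum>k<n. real (n choose k) * (0 + real k) ^ k * real (n - k) ^ (n - k - 1) / fact n)"
      by (intro sum.cong) (auto simp: pow_fps_def tree_fps_def binomial_fact field_simps)
    also have "\<dots> = real n ^ n / fact n"
      unfolding sum_divide_distrib[symmetric]
      using Abel_binomial[of n 0] False by (simp add: power_eq_if)
    finally show ?thesis using False by (simp add: algebra_simps pow_fps_def)
  qed
qed

text \<open>The operator x d/dx multiplies the n-th coefficient by n, turning n^(n-1) into n^n; the
  subtracted 1 is the constant term 0^0 of \<open>pow_fps\<close>.\<close>

lemma X_deriv_tree_fps: "fps_X * fps_deriv tree_fps = pow_fps - 1"
proof (rule fps_ext)
  fix n
  show "fps_nth (fps_X * fps_deriv tree_fps) n = fps_nth (pow_fps - 1) n"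
  proof (cases n)
    case (Suc k)
    have "(real k + 1) * (real k + 1) ^ k = (real k + 1) ^ Suc k" by simp
    then show ?thesis using Suc by (simp add: tree_fps_def pow_fps_def divide_simps add_ac del: power_Suc)
  qed (simp add: tree_fps_def pow_fps_def)
qed

text \<open>Differentiating G (1 - T) = 1 gives G' = G^2 T', and x T' = G - 1.\<close>

lemma X_deriv_pow_fps: "fps_X * fps_deriv pow_fps = pow_fps ^ 2 * (pow_fps - 1)"
proof -
  have "fps_deriv (pow_fps * (1 - tree_fps)) = 0" by (simp add: pow_fps_tree_fps)
  then have 1: "fps_deriv pow_fps * (1 - tree_fps) = pow_fps * fps_deriv tree_fps"
    by (simp add: algebra_simps)
  have "fps_deriv pow_fps = fps_deriv pow_fps * (pow_fps * (1 - tree_fps))"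
    by (simp add: pow_fps_tree_fps)
  also have "\<dots> = pow_fps ^ 2 * fps_deriv tree_fps"
    using 1 by (simp add: power2_eq_square mult_ac)
  finally have "fps_X * fps_deriv pow_fps = pow_fps ^ 2 * (fps_X * fps_deriv tree_fps)"
    by (simp add: mult_ac)
  then show ?thesis by (simp add: X_deriv_tree_fps)
qed

text \<open>Compares coefficients in x (G^m)' = m G^(m-1) (x G') = m (G^(m+2) - G^(m+1)).\<close>

lemma pow_fps_power_rec:
  assumes "m \<ge> 1"
  shows "real n * fps_nth (pow_fps ^ m) n = real m * (fps_nth (pow_fps ^ (m + 2)) n - fps_nth (pow_fps ^ (m + 1)) n)"
proof -
  obtain p where p: "m = Suc p" using assms by (cases m) auto
  have "fps_X * fps_deriv (pow_fps ^ m) = of_nat m * (pow_fps ^ p * (fps_X * fps_deriv pow_fps))"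
    by (simp only: fps_deriv_power' p diff_Suc_1 mult_ac)
  also have "\<dots> = of_nat m * (pow_fps ^ (m + 2) - pow_fps ^ (m + 1))"
    by (simp add: X_deriv_pow_fps p power2_eq_square algebra_simps)
  finally have "fps_nth (fps_X * fps_deriv (pow_fps ^ m)) n = fps_nth (of_nat m * (pow_fps ^ (m + 2) - pow_fps ^ (m + 1))) n"
    by simp
  moreover have "fps_nth (fps_X * fps_deriv (pow_fps ^ m)) n = real n * fps_nth (pow_fps ^ m) n"
    by (cases n) auto
  ultimately show ?thesis by (simp add: fps_of_nat[symmetric] del: power_Suc)
qed


section \<open>Stirling's formula with error bounds\<close>

text \<open>In the series 2 (u + u^3/3 + u^5/5 + ...), keeping only the first term gives the lower
  bound; replacing the denominators 5, 7, ... by 3 leaves a geometric series and gives the upper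
  one. The proof compares derivatives instead.\<close>

lemma ln_quotient_bounds:
  fixes u :: real
  assumes "0 \<le> u" "u < 1"
  shows "2 * u \<le> ln ((1 + u) / (1 - u))"
    and "ln ((1 + u) / (1 - u)) \<le> 2 * u + 2 / 3 * (u ^ 3 / (1 - u\<^sup>2))"
proof -
  define f where "f x = ln (1 + x) - ln (1 - x) - 2 * x" for x :: real
  define g where "g x = 2 * x + 2 / 3 * (x ^ 3 / (1 - x\<^sup>2)) - (ln (1 + x) - ln (1 - x))" for x :: real
  have ln: "ln ((1 + u) / (1 - u)) = ln (1 + u) - ln (1 - u)" using assms by (simp add: ln_div)
  have sq: "x\<^sup>2 < 1" if "0 \<le> x" "x < 1" for x :: real using that by (simp add: power_less_one_iff abs_square_less_1)
  have "f 0 \<le> f u"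
  proof (rule DERIV_nonneg_imp_nondecreasing[OF assms(1)])
    fix x assume x: "0 \<le> x" "x \<le> u"
    have "(f has_real_derivative (1 / (1 + x) + 1 / (1 - x) - 2)) (at x)"
      unfolding f_def using x assms by (auto intro!: derivative_eq_intros simp: divide_simps)
    moreover have "1 / (1 + x) + 1 / (1 - x) - 2 = 2 * x\<^sup>2 / (1 - x\<^sup>2)"
      using x assms sq[of x] by (simp add: divide_simps power2_eq_square) (simp add: algebra_simps)
    moreover have "2 * x\<^sup>2 / (1 - x\<^sup>2) \<ge> 0" using sq[of x] x assms by simp
    ultimately show "\<exists>y. DERIV f x :> y \<and> y \<ge> 0" by metis
  qed
  then show "2 * u \<le> ln ((1 + u) / (1 - u))" by (simp add: ln f_def)
  have "g 0 \<le> g u"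
  proof (rule DERIV_nonneg_imp_nondecreasing[OF assms(1)])
    fix x assume x: "0 \<le> x" "x \<le> u"
    have nz: "1 - x\<^sup>2 > 0" using sq[of x] x assms by simp
    have "(g has_real_derivative (2 + 2 / 3 * ((3 * x ^ 2 * (1 - x\<^sup>2) + x ^ 3 * (2 * x)) / (1 - x\<^sup>2)\<^sup>2)
        - (1 / (1 + x) + 1 / (1 - x)))) (at x)"
      unfolding g_def using x assms nz
      by (auto intro!: derivative_eq_intros simp: power2_eq_square[of "1 - x\<^sup>2"])
        (simp add: divide_simps; simp add: algebra_simps)
    moreover have "1 / (1 + x) + 1 / (1 - x) = 2 / (1 - x\<^sup>2)"
      using x assms nz by (simp add: divide_simps power2_eq_square) (simp add: algebra_simps)
    moreover have "2 + 2 / 3 * ((3 * x ^ 2 * (1 - x\<^sup>2) + x ^ 3 * (2 * x)) / (1 - x\<^sup>2)\<^sup>2) - 2 / (1 - x\<^sup>2)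
      = 4 / 3 * x ^ 4 / (1 - x\<^sup>2)\<^sup>2"
    proof -
      define d where "d = 1 - x\<^sup>2"
      have "x ^ 4 = (1 - d)\<^sup>2" by (simp add: d_def flip: power_mult)
      moreover have "x ^ 3 * (2 * x) = 2 * x ^ 4" by (simp add: power4_eq_xxxx power3_eq_cube)
      moreover have "x\<^sup>2 = 1 - d" by (simp add: d_def)
      moreover have "d \<noteq> 0" using nz by (simp add: d_def)
      ultimately show ?thesis unfolding d_def[symmetric]
        by (simp add: divide_simps) (simp add: algebra_simps power2_eq_square)
    qed
    moreover have "4 / 3 * x ^ 4 / (1 - x\<^sup>2)\<^sup>2 \<ge> 0" by simp
    ultimately show "\<exists>y. DERIV g x :> y \<and> y \<ge> 0" by metis
  qed
  then show "ln ((1 + u) / (1 - u)) \<le> 2 * u + 2 / 3 * (u ^ 3 / (1 - u\<^sup>2))" by (simp add: ln g_def)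
qed

text \<open>The logarithm of n! / (n^(n + 1/2) e^(-n)), whose limit is the logarithm of Stirling's
  constant sqrt (2 pi).\<close>

definition stirling_err :: "nat \<Rightarrow> real" where
  "stirling_err n = ln (fact n) - (real n + 1 / 2) * ln (real n) + real n"

text \<open>Makes \<open>stirling_err n\<close> decrease and
  \<open>stirling_err n - 1 / (12 * n)\<close> increase, so that both enclose the common
  limit.\<close>

lemma stirling_err_step:
  assumes "n \<ge> 1"
  shows "0 \<le> stirling_err n - stirling_err (Suc n)"
    and "stirling_err n - stirling_err (Suc n) \<le> 1 / (12 * real n) - 1 / (12 * real (Suc n))"
proof -
  define x where "x = real n"
  have x: "x \<ge> 1" using assms by (simp add: x_def)
  \<comment> \<open>Chosen so that (1 + u) / (1 - u) = (x + 1) / x; then (x + 1/2) * 2 u = 1 cancels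
    the -1 in the difference of errors.\<close>
  define u where "u = 1 / (2 * x + 1)"
  have u: "0 < u" "u < 1" using x by (auto simp: u_def)
  have q: "(1 + u) / (1 - u) = (x + 1) / x" using x by (simp add: u_def divide_simps)
  have "stirling_err n - stirling_err (Suc n) = (x + 1 / 2) * (ln (x + 1) - ln x) - 1"
  proof -
    have "ln (fact (Suc n)) = ln (x + 1) + ln (fact n)"
      using x by (simp add: ln_mult x_def add_ac flip: distrib_right)
    then show ?thesis using x by (simp add: stirling_err_def x_def add_ac del: fact_Suc) (simp add: algebra_simps)
  qed
  also have "ln (x + 1) - ln x = ln ((1 + u) / (1 - u))" unfolding q using x by (simp add: ln_div)
  finally have e: "stirling_err n - stirling_err (Suc n) = (x + 1 / 2) * ln ((1 + u) / (1 - u)) - 1" .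
  have "(x + 1 / 2) * (2 * u) \<le> (x + 1 / 2) * ln ((1 + u) / (1 - u))"
    using x u ln_quotient_bounds(1)[of u] by (intro mult_left_mono) auto
  moreover have "(x + 1 / 2) * (2 * u) = 1" using x by (simp add: u_def divide_simps)
  ultimately show "0 \<le> stirling_err n - stirling_err (Suc n)" using e by simp
  have up: "(x + 1 / 2) * ln ((1 + u) / (1 - u)) \<le> (x + 1 / 2) * (2 * u + 2 / 3 * (u ^ 3 / (1 - u\<^sup>2)))"
    using x u ln_quotient_bounds(2)[of u] by (intro mult_left_mono) auto
  have "(x + 1 / 2) * (2 * u + 2 / 3 * (u ^ 3 / (1 - u\<^sup>2))) = 1 + 1 / (12 * x) - 1 / (12 * (x + 1))"
  proof -
    define w where "w = 2 * x + 1"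
    have w: "w > 1" "x + 1/2 = w / 2" "x = (w - 1) / 2" using x by (auto simp: w_def)
    have w2: "w\<^sup>2 \<noteq> 1" using w by (simp add: power2_eq_1_iff)
    have "u ^ 3 / (1 - u\<^sup>2) = 1 / (w * (w\<^sup>2 - 1))"
      using w w2 by (simp add: u_def w_def[symmetric] divide_simps power3_eq_cube power2_eq_square)
    then have "(x + 1 / 2) * (2 * u + 2 / 3 * (u ^ 3 / (1 - u\<^sup>2))) = 1 + 1 / (3 * (w\<^sup>2 - 1))"
      using w w2 by (simp add: u_def w_def[symmetric] divide_simps)
        (simp add: algebra_simps power_numeral_reduce)
    also have "w\<^sup>2 - 1 = 4 * (x * (x + 1))" by (simp add: w_def power2_eq_square algebra_simps)
    also have "1 + 1 / (3 * (4 * (x * (x + 1)))) = 1 + 1 / (12 * x) - 1 / (12 * (x + 1))"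
      using x by (simp add: divide_simps) (simp add: algebra_simps)
    finally show ?thesis .
  qed
  with e up have "stirling_err n - stirling_err (Suc n) \<le> 1 / (12 * x) - 1 / (12 * (x + 1))"
    by linarith
  then show "stirling_err n - stirling_err (Suc n) \<le> 1 / (12 * real n) - 1 / (12 * real (Suc n))"
    by (simp only: x_def of_nat_Suc add.commute)
qed

text \<open>In this form the logarithm of the Wallis product can be expressed by
  \<open>stirling_err n\<close> and \<open>stirling_err (2 * n)\<close>.\<close>

lemma wallis_product_closed_form:
  "(\<Prod>k=1..n. (4 * real k ^ 2) / (4 * real k ^ 2 - 1)) = (4 ^ n * fact n ^ 2 / fact (2 * n)) ^ 2 / real (2 * n + 1)"
proof (induction n)
  case (Suc n)
  define c where "c = 4 ^ n * fact n ^ 2 / (fact (2 * n) :: real)"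
  have "(\<Prod>k=1..Suc n. (4 * real k ^ 2) / (4 * real k ^ 2 - 1))
     = c ^ 2 / real (2 * n + 1) * ((4 * real (Suc n) ^ 2) / (4 * real (Suc n) ^ 2 - 1))"
    using Suc.IH by (simp add: c_def del: of_nat_Suc)
  also have "4 * real (Suc n) ^ 2 - 1 = (2 * real n + 1) * (2 * real n + 3)"
    by (simp add: power2_eq_square algebra_simps)
  also have "c ^ 2 / real (2 * n + 1) * (4 * real (Suc n) ^ 2 / ((2 * real n + 1) * (2 * real n + 3)))
    = (c * (2 * real (Suc n) / (2 * real n + 1))) ^ 2 / (2 * real n + 3)"
    by (simp add: power_mult_distrib power_divide del: of_nat_Suc) (simp add: power2_eq_square add_ac)
  also have "c * (2 * real (Suc n) / (2 * real n + 1)) = 4 ^ Suc n * fact (Suc n) ^ 2 / fact (2 * Suc n)"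
  proof -
    define a b where "a = real n + 1" and "b = 2 * real n + 1"
    have "(fact (2 * Suc n) :: real) = 2 * a * b * fact (2 * n)"
      by (simp add: a_def b_def algebra_simps)
    moreover have "(fact (Suc n) :: real) = a * fact n" by (simp add: a_def)
    moreover have "real (Suc n) = a" "a \<noteq> 0" "b \<noteq> 0" by (auto simp: a_def b_def)
    ultimately show ?thesis unfolding c_def b_def[symmetric]
      by (simp add: divide_simps power2_eq_square del: fact_Suc of_nat_Suc mult_Suc_right)
  qed
  finally show ?case by (simp add: add_ac del: fact_Suc)
qed simp

text \<open>Monotonicity gives some limit L. Wallis' product identifies it:
  \<open>2 * stirling_err n - stirling_err (2 * n)\<close> tends to 2 L - L = L and also to half the
  sum of ln (pi / 2) and ln 4.\<close>

lemma stirling_err_limit: "stirling_err \<longlonglongrightarrow> ln (2 * pi) / 2"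
proof -
  \<comment> \<open>Shifted because \<open>stirling_err_step\<close> starts at 1.\<close>
  define s where "s n = stirling_err (Suc n)" for n
  have decs: "decseq s"
    unfolding decseq_Suc_iff s_def using stirling_err_step(1) by (metis diff_ge_0_iff_ge le_add1 plus_1_eq_Suc)
  have incs: "incseq (\<lambda>n. s n - 1 / (12 * real (Suc n)))"
    unfolding incseq_Suc_iff s_def using stirling_err_step(2)[of "Suc _"] by (smt (verit) Suc_le_mono le0 One_nat_def)
  have "s 0 - 1 \<le> s n" for n
  proof -
    have "s 0 - 1 / 12 \<le> s n - 1 / (12 * real (Suc n))"
      using incseqD[OF incs, of 0 n] by simp
    moreover have "1 / (12 * real (Suc n)) \<ge> 0" by simp
    ultimately show ?thesis by linarith
  qed
  then obtain L where L: "s \<longlonglongrightarrow> L" using decseq_convergent[OF decs, of "s 0 - 1"] by metis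
  then have lim: "stirling_err \<longlonglongrightarrow> L" unfolding s_def by (rule LIMSEQ_imp_Suc)
  define W where "W n = (\<Prod>k=1..n. (4 * real k ^ 2) / (4 * real k ^ 2 - 1))" for n
  have W: "W \<longlonglongrightarrow> pi / 2" unfolding W_def by (rule wallis)
  have l1: "(\<lambda>n. 2 * stirling_err n - stirling_err (2 * n)) \<longlonglongrightarrow> 2 * L - L"
    using LIMSEQ_subseq_LIMSEQ[OF lim, of "\<lambda>n. 2 * n"]
    by (intro tendsto_intros lim) (simp add: o_def strict_mono_def)
  have l2: "(\<lambda>n. ln (W n) / 2 + ln (4 + 2 / real n) / 2) \<longlonglongrightarrow> ln (pi / 2) / 2 + ln (4 + 0) / 2"
    by (intro tendsto_intros W) (auto intro: lim_const_over_n)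
  have l3: "\<forall>\<^sub>F n in sequentially. ln (W n) / 2 + ln (4 + 2 / real n) / 2 = 2 * stirling_err n - stirling_err (2 * n)"
    using eventually_gt_at_top[of 0]
  proof eventually_elim
    case (elim n)
    define c where "c = 4 ^ n * fact n ^ 2 / (fact (2 * n) :: real)"
    have c: "c > 0" by (simp add: c_def)
    have "ln (W n) = 2 * ln c - ln (real (2 * n + 1))"
      unfolding W_def wallis_product_closed_form c_def[symmetric] using c by (simp add: ln_div ln_realpow)
    moreover have "ln c = real n * ln 4 + 2 * ln (fact n) - ln (fact (2 * n))"
      by (simp add: c_def ln_div ln_mult ln_realpow)
    moreover have "ln (4 + 2 / real n) = ln 2 + ln (real (2 * n + 1)) - ln (real n)"
    proof -
      have "4 + 2 / real n = 2 * real (2 * n + 1) / real n" using elim by (simp add: field_simps)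
      then have "ln (4 + 2 / real n) = ln (2 * real (2 * n + 1)) - ln (real n)"
        using elim by (simp only: ln_div) simp
      also have "ln (2 * real (2 * n + 1)) = ln 2 + ln (real (2 * n + 1))"
        by (simp only: ln_mult) simp
      finally show ?thesis .
    qed
    moreover have "ln (4 :: real) = 2 * ln 2" using ln_realpow[of 2 2] by simp
    moreover have "ln (real (2 * n)) = ln 2 + ln (real n)" using elim by (simp add: ln_mult)
    ultimately show ?case
      by (simp only: stirling_err_def of_nat_mult of_nat_numeral) (simp add: field_simps)
  qed
  have "2 * L - L = ln (pi / 2) / 2 + ln (4 + 0) / 2"
    by (rule LIMSEQ_unique[OF l1 Lim_transform_eventually[OF l2 l3]])
  moreover have "ln (pi / 2) + ln 4 = ln (2 * pi)"
    using ln_mult[of "pi / 2" 4] by (simp add: mult.commute)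
  ultimately have "L = ln (2 * pi) / 2" by (simp add: field_simps)
  with lim show ?thesis by simp
qed

lemma stirling_err_bounds:
  assumes "n \<ge> 1"
  shows "ln (2 * pi) / 2 \<le> stirling_err n" "stirling_err n \<le> ln (2 * pi) / 2 + 1 / (12 * real n)"
proof -
  have lim: "(\<lambda>k. stirling_err (k + n)) \<longlonglongrightarrow> ln (2 * pi) / 2"
    by (rule LIMSEQ_ignore_initial_segment[OF stirling_err_limit])
  have "decseq (\<lambda>k. stirling_err (k + n))"
    unfolding decseq_Suc_iff using stirling_err_step(1) assms by (simp add: le_diff_eq)
  from decseq_ge[OF this lim, of 0] show "ln (2 * pi) / 2 \<le> stirling_err n" by simp
  have "incseq (\<lambda>k. stirling_err (k + n) - 1 / (12 * real (k + n)))"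
    unfolding incseq_Suc_iff using stirling_err_step(2)[of "_ + n"] assms by (smt (verit) add_Suc le_add2 order_trans)
  moreover have "(\<lambda>k. stirling_err (k + n) - (1 / 12) * (1 / real (k + n))) \<longlonglongrightarrow> ln (2 * pi) / 2 - (1 / 12) * 0"
    by (intro tendsto_intros lim LIMSEQ_ignore_initial_segment[OF lim_1_over_n])
  ultimately show "stirling_err n \<le> ln (2 * pi) / 2 + 1 / (12 * real n)"
    using incseq_le[of "\<lambda>k. stirling_err (k + n) - 1 / (12 * real (k + n))" "ln (2 * pi) / 2" 0] by simp
qed

lemma ln_fact_bounds:
  assumes "n \<ge> 1"
  shows "real n * ln (real n) - real n + ln (2 * pi * real n) / 2 \<le> ln (fact n)"
    and "ln (fact n) \<le> real n * ln (real n) - real n + ln (2 * pi * real n) / 2 + 1 / (12 * real n)"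
  using stirling_err_bounds[OF assms] assms
  by (simp_all add: stirling_err_def ln_mult field_simps)


section \<open>Elementary estimates\<close>

lemma exp_partial_sum_le:
  assumes "0 \<le> (x::real)"
  shows "(\<Sum>k<n. x ^ k / fact k) \<le> exp x"
proof -
  have "exp x = (\<Sum>k. x ^ k / fact k)" by (simp add: exp_def divide_inverse mult.commute)
  moreover have "summable (\<lambda>k. x ^ k / fact k)"
    using summable_exp_generic[of x] by (simp add: divide_inverse mult.commute)
  ultimately show ?thesis using assms sum_le_suminf[of "\<lambda>k. x ^ k / fact k" "{..<n}"] by simp
qed

text \<open>Reduces an upper bound on the logarithm of a numeral to rational arithmetic.\<close>

lemma ln_le_of_partial_sum:
  assumes "0 < (a::real)" "0 \<le> x" "a \<le> (\<Sum>k<n. x ^ k / fact k)"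
  shows "ln a \<le> x"
  using exp_partial_sum_le[of x n] assms by (metis exp_le_cancel_iff exp_ln order_trans)

lemma ln_le_tangent:
  assumes "(0::real) < a" "0 < x"
  shows "ln x \<le> ln a + (x / a - 1)"
  using ln_le_minus_one[of "x / a"] assms by (simp add: ln_div)

lemma ln_5_le: "ln (5::real) \<le> 1.66"
  by (rule ln_le_of_partial_sum[where n = 6]) (simp_all add: eval_nat_numeral fact_numeral)

lemma ln_21_le: "ln (21::real) \<le> 3.055"
  by (rule ln_le_of_partial_sum[where n = 12]) (simp_all add: eval_nat_numeral fact_numeral)

lemma ln_100_le: "ln (100::real) \<le> 4.76"
  by (rule ln_le_of_partial_sum[where n = 12]) (simp_all add: eval_nat_numeral fact_numeral)

text \<open>Meant for y = 4 n with n >= 100. With w = ln y >= 5, the tangent of the logarithm at 5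
  has slope 1/5 < 1/3 and value ln 5 < 5/3.\<close>

lemma ln_ln_le:
  assumes "(400::real) \<le> y"
  shows "ln (ln y) \<le> ln y / 3" "5 \<le> ln y"
proof -
  have "exp (5::real) = exp 1 ^ 5" by (simp flip: exp_of_nat_mult)
  also have "\<dots> \<le> 3 ^ 5" by (intro power_mono exp_le) auto
  finally have "exp (5::real) \<le> y" using assms by simp
  then show w: "5 \<le> ln y" using assms by (simp add: ln_ge_iff)
  have "ln (ln y) \<le> ln 5 + (ln y / 5 - 1)" using w by (intro ln_le_tangent) auto
  then show "ln (ln y) \<le> ln y / 3" using w ln_5_le by simp
qed

text \<open>The source of the 21 in \<open>N_fun\<close>: the inequality fails at y = 20 and holds
  at 21 by a margin of about 0.015.\<close>

lemma ln_le_sqrt: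
  assumes "(21::real) \<le> y"
  shows "1.5 * ln y \<le> sqrt y"
proof -
  define s where "s = sqrt y"
  have "sqrt 21 \<ge> (4.5825 :: real)" by (rule real_le_rsqrt) (simp add: power2_eq_square)
  then have s21: "sqrt 21 > (3::real)" by simp
  have s: "sqrt 21 \<le> s" "y = s ^ 2" using assms by (simp_all add: s_def)
  have "ln (sqrt 21) = ln 21 / 2" by (simp add: ln_sqrt)
  moreover have "ln s \<le> ln (sqrt 21) + (s / sqrt 21 - 1)"
    using s s21 by (intro ln_le_tangent) linarith+
  \<comment> \<open>With slope 1/3 the bound on \<open>3 * ln s\<close> is s plus the constant 1.5
    ln 21 - sqrt 21, which is negative.\<close>
  moreover have "s / sqrt 21 - 1 \<le> (s - sqrt 21) / 3"
  proof -
    have "s / sqrt 21 - 1 = (s - sqrt 21) / sqrt 21" using s21 by (simp add: diff_divide_distrib)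
    also have "\<dots> \<le> (s - sqrt 21) / 3" using s s21 by (intro divide_left_mono) auto
    finally show ?thesis .
  qed
  ultimately have "3 * ln s \<le> s" using ln_21_le \<open>sqrt 21 \<ge> 4.5825\<close> by simp
  moreover have "ln y = 2 * ln s" unfolding s(2) using s s21 by (simp add: ln_realpow)
  ultimately show ?thesis by (simp add: s_def)
qed

text \<open>Holds because 100 / ln 100 is about 21.7; it serves small \<open>c1\<close> in
  \<open>threshold_nonpos\<close>.\<close>

lemma ln_le_div_21:
  assumes "(100::real) \<le> x"
  shows "21 * ln x \<le> x"
proof -
  have "ln x \<le> ln 100 + (x / 100 - 1)" using assms by (intro ln_le_tangent) auto
  then show ?thesis using ln_100_le assms by simp
qed

text \<open>Here \<open>n0\<close> replaces the root of n = c1 ln n + c2 by an explicit value. From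
  n0 <= y^1.5 follows ln n0 <= 1.5 ln y, so the claim holds at \<open>n0\<close>; it persists
  because n - c1 ln n increases for n >= c1. The two branches of \<open>N_fun\<close> use y = c1 +
  c2 and y = c1.\<close>

lemma threshold_tail:
  fixes c1 c2 y n n0 :: real
  assumes y: "21 \<le> y" and c1: "0 < c1" and n0: "n0 = 1.5 * c1 * ln y + c2"
    and ge: "c1 \<le> n0" and le: "n0 \<le> 1.5 * y * ln y" and n: "n0 \<le> n"
  shows "c1 * ln n + c2 \<le> n"
proof -
  have "1.5 * y * ln y = y * (1.5 * ln y)" by simp
  also have "\<dots> \<le> y * sqrt y" using ln_le_sqrt[OF y] y by (intro mult_left_mono) auto
  finally have "n0 \<le> y * sqrt y" using le by linarith
  then have "ln n0 \<le> ln (y * sqrt y)" using ge c1 by (intro ln_mono) auto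
  also have "\<dots> = 1.5 * ln y" using y by (simp add: ln_mult ln_sqrt)
  finally have "c1 * ln n0 \<le> 1.5 * c1 * ln y" using c1 by simp
  moreover have "ln n \<le> ln n0 + (n / n0 - 1)" using ge c1 n by (intro ln_le_tangent) auto
  then have "c1 * ln n \<le> c1 * (ln n0 + (n / n0 - 1))" using c1 by simp
  moreover have "c1 * (n / n0 - 1) \<le> n - n0"
  proof -
    have "c1 * (n / n0 - 1) \<le> n0 * (n / n0 - 1)" using ge c1 n by (intro mult_right_mono) auto
    also have "\<dots> = n - n0" using ge c1 by (simp add: algebra_simps)
    finally show ?thesis .
  qed
  ultimately show ?thesis using n0 by (simp add: distrib_left)
qed

lemma threshold_pos:
  fixes c1 c2 n :: real
  assumes "0 < c1" "0 < c2" "21 \<le> c1 + c2" "1.5 * c1 * ln (c1 + c2) + c2 \<le> n"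
  shows "c1 * ln n + c2 \<le> n"
proof -
  let ?y = "c1 + c2"
  have "1 \<le> ln ?y" using assms(3) exp_le by (subst ln_ge_iff) linarith+
  then have "c1 * 1 \<le> c1 * ln ?y" "c2 * 1 \<le> c2 * ln ?y"
    using assms by (intro mult_left_mono; simp)+
  moreover have "1.5 * ?y * ln ?y = 1.5 * (c1 * ln ?y) + 1.5 * (c2 * ln ?y)"
    "1.5 * c1 * ln ?y = 1.5 * (c1 * ln ?y)" by (simp_all add: algebra_simps)
  ultimately have "c1 \<le> 1.5 * c1 * ln ?y + c2" "1.5 * c1 * ln ?y + c2 \<le> 1.5 * ?y * ln ?y"
    using assms by linarith+
  then show ?thesis using assms threshold_tail[of ?y c1 "1.5 * c1 * ln ?y + c2"] by blast
qed

text \<open>For \<open>c2\<close> so negative that the threshold falls below \<open>c1\<close>, the minimum of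
  \<open>n - c1 * ln n\<close>, attained at \<open>n = c1\<close>, already exceeds \<open>c2\<close>.\<close>

lemma threshold_nonpos:
  fixes c1 c2 n :: real
  assumes "0 < c1" "c2 \<le> 0" "1.5 * c1 * ln c1 + c2 \<le> n" "100 \<le> n"
  shows "c1 * ln n + c2 \<le> n"
proof (cases "c1 \<le> 21")
  case True
  \<comment> \<open>Since y = c1 may lie below 21, \<open>threshold_tail\<close> cannot be relied
    on; \<open>n >= 100\<close> and \<open>c2 <= 0\<close> settle this range.\<close>
  then have "c1 * ln n \<le> 21 * ln n" using assms by (intro mult_right_mono) auto
  then show ?thesis using ln_le_div_21[of n] assms by linarith
next
  case False
  then have y: "21 \<le> c1" by simp
  show ?thesis
  proof (cases "c1 \<le> 1.5 * c1 * ln c1 + c2")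
    case True
    then show ?thesis using assms y
      by (intro threshold_tail[of c1 c1 "1.5 * c1 * ln c1 + c2"]) auto
  next
    case False
    have "1 \<le> ln c1" using y exp_le by (subst ln_ge_iff) linarith+
    then have "c1 * 1 \<le> c1 * ln c1" using y by (intro mult_left_mono) auto
    have "ln n \<le> ln c1 + (n / c1 - 1)" using y assms by (intro ln_le_tangent) auto
    then have "c1 * ln n \<le> c1 * (ln c1 + (n / c1 - 1))" using y by simp
    also have "\<dots> = c1 * ln c1 + n - c1" using y by (simp add: algebra_simps)
    finally have "c1 * ln n \<le> c1 * ln c1 + n - c1" .
    moreover have "1.5 * c1 * ln c1 = 1.5 * (c1 * ln c1)" by simp
    ultimately show ?thesis using False \<open>c1 * 1 \<le> c1 * ln c1\<close> y by linarith
  qed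
qed

text \<open>The quotients of \<open>T m\<close> by the bound are at most 0.171, 0.57, 0.57, 0.89, 0.68 for \<open>m = 1, \<dots>, 5\<close>;
  from \<open>m = 4\<close> on the recurrence keeps them below \<open>1 / 6 + 1 / (0.36 m) \<le> 1\<close>.\<close>

lemma recurrence_bound:
  fixes T :: "nat \<Rightarrow> real" and s :: real
  assumes s: "10 \<le> s" and T1: "T 1 \<le> 1" and T2: "T 2 \<le> 2 * s"
    and rec: "\<And>m. 1 \<le> m \<Longrightarrow> T (m + 2) = T (m + 1) + s\<^sup>2 / real m * T m"
    and m: "1 \<le> m"
  shows "T m \<le> 9.8 * 0.6 ^ m * s ^ (m - 1)"
proof -
  define B where "B m = 9.8 * 0.6 ^ m * s ^ (m - 1)" for m
  \<comment> \<open>In units of \<open>B\<close> the right-hand side of the recurrence is a / (0.6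
    s) + b / (0.36 m), and 0.6 s >= 6. The factor 9.8 cancels here and matters only for the starting
    values.\<close>
  have step: "T (m + 2) \<le> c * B (m + 2)"
    if "1 \<le> m" "T (m + 1) \<le> a * B (m + 1)" "T m \<le> b * B m" "0 \<le> a" "a / 6 + b / (0.36 * real m) \<le> c"
    for m a b c
  proof -
    define p where "p = m - 1"
    have p: "m = Suc p" using that(1) by (simp add: p_def)
    define P where "P = 9.8 * 0.6 ^ m * s ^ p"
    have P: "P \<ge> 0" using s by (simp add: P_def)
    have "T (m + 2) \<le> a * B (m + 1) + s\<^sup>2 / real m * (b * B m)"
      unfolding rec[OF that(1)] using that by (intro add_mono mult_left_mono) auto
    also have "\<dots> = 0.36 * s\<^sup>2 * P * (a / (0.6 * s) + b / (0.36 * real m))"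
    proof -
      have "a * B (m + 1) = 0.36 * s\<^sup>2 * P * (a / (0.6 * s))"
        using s by (simp add: B_def P_def p power2_eq_square)
      moreover have "s\<^sup>2 / real m * (b * B m) = 0.36 * s\<^sup>2 * P * (b / (0.36 * real m))"
      proof -
        have "B m = P" by (simp add: B_def P_def p)
        then show ?thesis using that(1) by (simp add: field_simps)
      qed
      ultimately show ?thesis by (simp only: distrib_left)
    qed
    also have "\<dots> \<le> 0.36 * s\<^sup>2 * P * c"
    proof (intro mult_left_mono)
      have "a / (0.6 * s) \<le> a / 6" using s that(4) by (intro divide_left_mono) auto
      then show "a / (0.6 * s) + b / (0.36 * real m) \<le> c" using that(5) by linarith
    qed (use P in auto)
    also have "\<dots> = c * B (m + 2)" by (simp add: B_def P_def p power2_eq_square)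
    finally show ?thesis .
  qed
  have b1: "T 1 \<le> 0.171 * B 1" using T1 by (simp add: B_def)
  have b2: "T 2 \<le> 0.57 * B 2" using T2 s by (simp add: B_def power2_eq_square)
  have b3: "T 3 \<le> 0.57 * B 3" using step[of 1 "0.57" "0.171" "0.57"] b1 b2 by (simp add: numeral_eq_Suc)
  have b4: "T 4 \<le> 0.89 * B 4" using step[of 2 "0.57" "0.57" "0.89"] b2 b3 by (simp add: numeral_eq_Suc)
  have b5: "T 5 \<le> 0.68 * B 5" using step[of 3 "0.89" "0.57" "0.68"] b3 b4 by (simp add: numeral_eq_Suc)
  have B0: "B m \<ge> 0" for m using s by (simp add: B_def)
  have "T (m + 4) \<le> B (m + 4) \<and> T (m + 5) \<le> B (m + 5)" for m
  proof (induction m)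
    case 0
    then show ?case using b4 b5 B0[of 4] B0[of 5] by simp
  next
    case (Suc m)
    have "1 / 6 + 1 / (0.36 * real (m + 4)) \<le> 1" by (simp add: divide_simps)
    then have "T (m + 4 + 2) \<le> 1 * B (m + 4 + 2)"
      using Suc by (intro step[where a = 1 and b = 1]) (auto simp: numeral_eq_Suc)
    then show ?case using Suc by (simp add: numeral_eq_Suc)
  qed
  note big = this
  have le: "T k \<le> B k" if "T k \<le> c * B k" "c \<le> 1" for k c
    using that mult_right_mono[of c 1 "B k"] B0[of k] by simp
  have "T m \<le> B m"
  proof -
    consider "m = 1" | "m = 2" | "m = 3" | "m \<ge> 4" using m by linarith
    then show ?thesis
    proof cases
      case 1 then show ?thesis using le[OF b1] by simp
    next
      case 2 then show ?thesis using le[OF b2] by simp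
    next
      case 3 then show ?thesis using le[OF b3] by simp
    next
      case 4 then show ?thesis using big[of "m - 4"] by simp
    qed
  qed
  then show ?thesis by (simp only: B_def)
qed


section \<open>The sum of the maximum likelihoods\<close>

text \<open>Compositions of n indexed by \<open>A\<close>; the value 0 outside \<open>A\<close>
  makes each of them a single function, so that sums count it once.\<close>

definition comps :: "'a set \<Rightarrow> nat \<Rightarrow> ('a \<Rightarrow> nat) set" where
  "comps A n = {\<nu>. (\<forall>i. i \<notin> A \<longrightarrow> \<nu> i = 0) \<and> sum \<nu> A = n}"

lemma finite_comps:
  assumes "finite A"
  shows "finite (comps A n)"
proof (rule finite_subset)
  show "comps A n \<subseteq> {\<nu>. \<forall>i. (i \<in> A \<longrightarrow> \<nu> i \<in> {..n}) \<and> (i \<notin> A \<longrightarrow> \<nu> i = 0)}"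
    using assms by (auto simp: comps_def intro: member_le_sum)
  show "finite {\<nu>. \<forall>i. (i \<in> A \<longrightarrow> \<nu> i \<in> {..n}) \<and> (i \<notin> A \<longrightarrow> \<nu> i = 0)}"
    using assms by (intro finite_set_of_finite_funs) auto
qed

text \<open>Expands the power into one factor per index; splitting off the value at one index is the
  Cauchy product.\<close>

lemma sum_comps_prod:
  fixes A :: "'a set"
  assumes "finite A"
  shows "(\<Sum>\<nu>\<in>comps A n. \<Prod>i\<in>A. fps_nth F (\<nu> i)) = fps_nth (F ^ card A) n"
  using assms
proof (induction A arbitrary: n rule: finite_induct)
  case empty
  have "comps ({} :: 'a set) n = (if n = 0 then {\<lambda>_. 0} else {})" by (auto simp: comps_def)
  then show ?case by (simp add: fps_one_nth)
next
  case (insert a A)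
  let ?f = "\<lambda>B \<nu>. \<Prod>i\<in>B. fps_nth F (\<nu> i)"
  have "(\<Sum>\<nu>\<in>comps (insert a A) n. ?f (insert a A) \<nu>)
    = (\<Sum>(k, \<nu>)\<in>(SIGMA k:{0..n}. comps A (n - k)). ?f (insert a A) (\<nu>(a := k)))"
  proof (rule sum.reindex_bij_witness[where i = "\<lambda>(k, \<nu>). \<nu>(a := k)" and j = "\<lambda>\<nu>. (\<nu> a, \<nu>(a := 0))"], goal_cases)
    case (1 \<nu>) then show ?case by simp
  next
    case (2 \<nu>)
    have "sum (\<nu>(a := 0)) A = sum \<nu> A" using insert.hyps by (intro sum.cong) auto
    then show ?case using 2 insert.hyps by (auto simp: comps_def)
  next
    case (3 x) then show ?case using insert.hyps by (auto simp: comps_def)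
  next
    case (4 x)
    obtain k \<nu> where x: "x = (k, \<nu>)" by (cases x)
    have "sum (\<nu>(a := k)) A = sum \<nu> A" using insert.hyps by (intro sum.cong) auto
    then show ?case using 4 insert.hyps x by (auto simp: comps_def)
  next
    case (5 \<nu>) then show ?case by (auto intro!: prod.cong)
  qed
  also have "\<dots> = (\<Sum>k=0..n. \<Sum>\<nu>\<in>comps A (n - k). fps_nth F k * ?f A \<nu>)"
  proof (subst sum.Sigma[symmetric], goal_cases)
    case 3
    have "?f (insert a A) (\<nu>(a := k)) = fps_nth F k * ?f A \<nu>" for \<nu> k
    proof -
      have "?f A (\<nu>(a := k)) = ?f A \<nu>" using insert.hyps by (intro prod.cong) auto
      then show ?thesis using insert.hyps by simp
    qed
    then show ?case by simp
  qed (use insert.hyps finite_comps in auto)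
  also have "\<dots> = (\<Sum>k=0..n. fps_nth F k * fps_nth (F ^ card A) (n - k))"
    by (simp add: insert.IH flip: sum_distrib_left)
  also have "\<dots> = fps_nth (F ^ card (insert a A)) n"
    using insert.hyps by (simp add: fps_mult_nth)
  finally show ?case .
qed

definition freq_of :: "nat \<Rightarrow> ('m \<Rightarrow> nat) \<Rightarrow> real^'m::finite" where
  "freq_of n \<nu> = (\<chi> i. real (\<nu> i) / real n)"

lemma freqs_eq: "freqs n = freq_of n ` comps UNIV n"
  by (auto simp: freqs_def freq_of_def comps_def vec_eq_iff image_iff)

lemma inj_freq_of: "n > 0 \<Longrightarrow> inj (freq_of n)"
  by (auto simp: inj_def freq_of_def vec_eq_iff fun_eq_iff)

lemma finite_freqs: "finite (freqs n)"
  by (simp add: freqs_eq finite_comps)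

lemma num_realizations_freq_of:
  "n > 0 \<Longrightarrow> num_realizations n (freq_of n \<nu>) = fact n / (\<Prod>i\<in>UNIV. fact (\<nu> i))"
  by (simp add: num_realizations_def freq_of_def)

text \<open>This is the maximum likelihood of a sequence with counts \<nu>. A zero count contributes
  0^0 = 1, in agreement with 0 ln 0 = 0.\<close>

lemma exp_entropy_freq_of:
  assumes "n > 0" "\<nu> \<in> comps UNIV n"
  shows "exp (- (real n * entropy (freq_of n \<nu>))) = (\<Prod>i\<in>UNIV. real (\<nu> i) ^ \<nu> i) / real n ^ n"
proof -
  have "- (real n * entropy (freq_of n \<nu>)) = (\<Sum>i\<in>UNIV. real (\<nu> i) * ln (real (\<nu> i) / real n))"
    using assms by (simp add: entropy_def freq_of_def sum_distrib_left)
  also have "exp \<dots> = (\<Prod>i\<in>UNIV. (real (\<nu> i) / real n) ^ \<nu> i)"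
    unfolding exp_sum[OF finite_class.finite_UNIV]
  proof (intro prod.cong refl)
    fix i
    show "exp (real (\<nu> i) * ln (real (\<nu> i) / real n)) = (real (\<nu> i) / real n) ^ \<nu> i"
      using assms(1) by (cases "\<nu> i = 0") (simp_all add: exp_of_nat_mult)
  qed
  also have "\<dots> = (\<Prod>i\<in>UNIV. real (\<nu> i) ^ \<nu> i) / real n ^ (\<Sum>i\<in>UNIV. \<nu> i)"
    by (simp add: power_divide prod_dividef power_sum)
  finally show ?thesis using assms(2) by (simp add: comps_def)
qed

text \<open>The normalizer of the maximum likelihood distribution of \<open>n\<close> draws from \<open>m\<close> categories.\<close>

definition shtarkov :: "nat \<Rightarrow> nat \<Rightarrow> real" where
  "shtarkov n m = fact n / real n ^ n * fps_nth (pow_fps ^ m) n"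

text \<open>The summand of \<nu> is n!/n^n times the product of the \<nu>_i^\<nu>_i / \<nu>_i!,
  which are coefficients of \<open>pow_fps\<close>.\<close>

lemma sum_freqs_shtarkov:
  assumes "n > 0"
  shows "(\<Sum>f\<in>freqs n. num_realizations n (f :: real^'m::finite) * exp (- (real n * entropy f)))
    = shtarkov n CARD('m)"
proof -
  have "(\<Sum>f\<in>freqs n. num_realizations n (f :: real^'m) * exp (- (real n * entropy f)))
    = (\<Sum>\<nu>\<in>comps (UNIV :: 'm set) n. num_realizations n (freq_of n \<nu>) * exp (- (real n * entropy (freq_of n \<nu>))))"
    unfolding freqs_eq using inj_freq_of[OF assms]
    by (subst sum.reindex) (auto intro: inj_on_subset)
  also have "\<dots> = (\<Sum>\<nu>\<in>comps (UNIV :: 'm set) n. fact n / real n ^ n * (\<Prod>i\<in>UNIV. fps_nth pow_fps (\<nu> i)))"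
    using assms by (intro sum.cong refl)
      (simp add: num_realizations_freq_of exp_entropy_freq_of pow_fps_def prod_dividef)
  also have "\<dots> = shtarkov n CARD('m)"
    unfolding shtarkov_def sum_distrib_left[symmetric] by (subst sum_comps_prod) simp_all
  finally show ?thesis .
qed

lemma shtarkov_1: "n > 0 \<Longrightarrow> shtarkov n 1 = 1"
  by (simp add: shtarkov_def pow_fps_def)

lemma shtarkov_rec:
  assumes "m \<ge> 1"
  shows "shtarkov n (m + 2) = shtarkov n (m + 1) + real n / real m * shtarkov n m"
proof -
  have "fps_nth (pow_fps ^ (m + 2)) n = fps_nth (pow_fps ^ (m + 1)) n + real n / real m * fps_nth (pow_fps ^ m) n"
    using pow_fps_power_rec[OF assms, of n] assms by (simp add: field_simps)
  then show ?thesis by (simp add: shtarkov_def distrib_left mult_ac)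
qed

lemma fact_self_power:
  assumes "n \<ge> 1"
  shows "fact n / real n ^ n \<le> exp (- real n) * sqrt (2 * pi * real n) * exp (1 / (12 * real n))"
    and "real n ^ n / fact n \<le> exp (real n) / sqrt (2 * pi * real n)"
proof -
  define L where "L = real n * ln (real n) - real n + ln (2 * pi * real n) / 2"
  have "L = ln (real n ^ n * exp (- real n) * sqrt (2 * pi * real n))"
    using assms by (simp add: L_def ln_mult ln_realpow ln_sqrt)
  then have L: "exp L = real n ^ n * exp (- real n) * sqrt (2 * pi * real n)" using assms by simp
  have "fact n = exp (ln (fact n :: real))" by simp
  also have "\<dots> \<le> exp (L + 1 / (12 * real n))" unfolding exp_le_cancel_iff
    using ln_fact_bounds(2)[OF assms] by (simp add: L_def)
  also have "\<dots> = real n ^ n * (exp (- real n) * sqrt (2 * pi * real n) * exp (1 / (12 * real n)))"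
    by (simp add: exp_add L)
  finally show "fact n / real n ^ n \<le> exp (- real n) * sqrt (2 * pi * real n) * exp (1 / (12 * real n))"
    using assms by (simp add: pos_divide_le_eq mult_ac)
  have "exp L \<le> exp (ln (fact n :: real))" unfolding exp_le_cancel_iff
    using ln_fact_bounds(1)[OF assms] by (simp add: L_def)
  then have "real n ^ n * exp (- real n) * sqrt (2 * pi * real n) \<le> fact n" by (simp add: L)
  then show "real n ^ n / fact n \<le> exp (real n) / sqrt (2 * pi * real n)"
    using assms by (simp add: divide_simps exp_minus mult_ac)
qed

text \<open>Telescopes 1 / a <= 2 (a - b) for a = sqrt (n + 1) and b = sqrt n, which is (a - b)^2 >=
  0 rewritten by a^2 - b^2 = 1.\<close>

lemma sum_inverse_sqrt_le: "(\<Sum>k=1..n. 1 / sqrt (real k)) \<le> 2 * sqrt (real n)"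
proof (induction n)
  case (Suc n)
  define a b where "a = sqrt (real (Suc n))" and "b = sqrt (real n)"
  have a: "a > 0" and ab: "a * a - b * b = 1" by (simp_all add: a_def b_def)
  have "0 \<le> (a - b) * (a - b)" by simp
  then have "1 \<le> (2 * (a - b)) * a" using ab by (simp add: algebra_simps)
  then have "1 / a \<le> 2 * (a - b)" using a by (simp add: pos_divide_le_eq)
  then show ?case using Suc.IH by (simp add: a_def b_def)
qed simp

lemma exp_small_le:
  assumes "n \<ge> 100"
  shows "exp (1 / (12 * real n)) \<le> 1.001"
proof -
  have "1 / (12 * real n) \<le> 1 / 1200" using assms by (intro divide_left_mono) auto
  also have "\<dots> \<le> ln 1.001" using ln_le_minus_one[of "1 / 1.001"] by (simp add: ln_div)
  finally show ?thesis by (simp add: ln_ge_iff)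
qed

text \<open>The second starting value of the recurrence. The two end terms of the convolution are 1
  each; Stirling's formula controls the others.\<close>

lemma shtarkov_2_le:
  assumes n: "n \<ge> 100"
  shows "shtarkov n 2 \<le> 2 * sqrt (real n)"
proof -
  define q where "q = fact n / real n ^ n"
  define g where "g k = q * (fps_nth pow_fps k * fps_nth pow_fps (n - k))" for k
  have "sqrt 6 \<ge> (2.44 :: real)" by (rule real_le_rsqrt) (simp add: power2_eq_square)
  moreover have "sqrt (2 * pi) \<ge> sqrt 6" using pi_gt3 by simp
  ultimately have pi: "sqrt (2 * pi) \<ge> 2.44" by linarith
  have g: "g k \<le> 0.45 * (1 / sqrt (real k) + 1 / sqrt (real (n - k)))" if k: "k \<in> {1..n-1}" for k
  proof -
    define x y z where "x = sqrt (real k)" and "y = sqrt (real (n - k))" and "z = sqrt (real n)"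
    have pos: "x > 0" "y > 0" "z > 0" using k n by (auto simp: x_def y_def z_def)
    have nk: "real (n - k) = real n - real k" by (subst of_nat_diff) (use k in auto)
    \<comment> \<open>Subadditivity of the square root separates k from n - k: z / (x y) <= 1/x +
      1/y.\<close>
    have zxy: "z \<le> x + y" unfolding x_def y_def z_def using sqrt_add_le_add_sqrt[of "real k" "real (n - k)"] nk by simp
    have "g k \<le> (exp (- real n) * sqrt (2 * pi * real n) * exp (1 / (12 * real n)))
        * ((exp (real k) / sqrt (2 * pi * real k)) * (exp (real (n - k)) / sqrt (2 * pi * real (n - k))))"
      unfolding g_def q_def pow_fps_def fps_nth_Abs_fps
      using k n by (intro mult_mono fact_self_power) auto
    also have "\<dots> = exp (1 / (12 * real n)) / sqrt (2 * pi) * (z / (x * y))"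
    proof -
      define S where "S = sqrt (2 * pi)"
      have S: "S \<noteq> 0" using pi by (auto simp: S_def)
      have sq: "sqrt (2 * pi * real n) = S * z" "sqrt (2 * pi * real k) = S * x"
        "sqrt (2 * pi * real (n - k)) = S * y"
        by (simp_all add: real_sqrt_mult S_def x_def y_def z_def)
      have "exp (- real n) * (exp (real k) * exp (real (n - k))) = 1"
        unfolding nk by (simp flip: exp_add)
      moreover have "e * (S * z) * w * (u / (S * x) * (v / (S * y))) = (e * (u * v)) * (w / S * (z / (x * y)))"
        for e u v w using S pos by (simp add: field_simps)
      ultimately show ?thesis unfolding sq S_def[symmetric] by simp
    qed
    also have "\<dots> \<le> 0.45 * ((x + y) / (x * y))"
    proof (intro mult_mono divide_right_mono zxy)
      have "exp (1 / (12 * real n)) / sqrt (2 * pi) \<le> 1.001 / 2.44"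
        using exp_small_le[OF n] pi by (intro frac_le) auto
      also have "\<dots> \<le> (0.45 :: real)" by simp
      finally show "exp (1 / (12 * real n)) / sqrt (2 * pi) \<le> 0.45" .
    qed (use pos in auto)
    also have "(x + y) / (x * y) = 1 / x + 1 / y" using pos by (simp add: field_simps)
    finally show ?thesis by (simp add: x_def y_def)
  qed
  have "shtarkov n 2 = (\<Sum>k=0..n. g k)"
    unfolding shtarkov_def g_def q_def power2_eq_square fps_mult_nth by (rule sum_distrib_left)
  also have "{0..n} = insert 0 (insert n {1..n-1})" using n by auto
  also have "sum g \<dots> = 2 + sum g {1..n-1}"
    using n by (simp add: g_def q_def pow_fps_def)
  also have "sum g {1..n-1} \<le> (\<Sum>k=1..n-1. 0.45 * (1 / sqrt (real k) + 1 / sqrt (real (n - k))))"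
    by (intro sum_mono g)
  also have "\<dots> = 0.45 * ((\<Sum>k=1..n-1. 1 / sqrt (real k)) + (\<Sum>k=1..n-1. 1 / sqrt (real (n - k))))"
    by (simp only: sum.distrib flip: sum_distrib_left)
  also have "(\<Sum>k=1..n-1. 1 / sqrt (real (n - k))) = (\<Sum>k=1..n-1. 1 / sqrt (real k))"
    by (rule sum.reindex_bij_witness[where i = "\<lambda>k. n - k" and j = "\<lambda>k. n - k"]) auto
  finally have "shtarkov n 2 \<le> 2 + 0.45 * (2 * (\<Sum>k=1..n-1. 1 / sqrt (real k)))" by simp
  moreover have "(\<Sum>k=1..n-1. 1 / sqrt (real k)) \<le> 2 * sqrt (real n)"
    using sum_inverse_sqrt_le[of "n - 1"] by (rule order_trans) (use n in simp)
  \<comment> \<open>What remains is 2 + 1.8 sqrt n <= 2 sqrt n, which is exactly sqrt n >=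
    10.\<close>
  moreover have "10 \<le> sqrt (real n)" using n by (intro real_le_rsqrt) simp
  ultimately show ?thesis by simp
qed

lemma shtarkov_le:
  assumes "n \<ge> 100" "m \<ge> 1"
  shows "shtarkov n m \<le> 9.8 * 0.6 ^ m * sqrt (real n) ^ (m - 1)"
proof (rule recurrence_bound)
  show "10 \<le> sqrt (real n)" using assms by (intro real_le_rsqrt) simp
  show "shtarkov n 1 \<le> 1" using shtarkov_1 assms by simp
  show "shtarkov n 2 \<le> 2 * sqrt (real n)" using shtarkov_2_le assms by simp
  show "shtarkov n (m + 2) = shtarkov n (m + 1) + (sqrt (real n))\<^sup>2 / real m * shtarkov n m"
    if "1 \<le> m" for m using shtarkov_rec that by simp
qed (use assms in simp)


section \<open>Rounding the maximum entropy vector\<close>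

text \<open>Deleting a smallest element does not lower the mean, so after \<open>d\<close> deletions
  the mean of the remaining \<open>s\<close> elements is at least that of \<open>I\<close>. The form
  without quotients also covers s = 0.\<close>

lemma top_subset_exists:
  fixes r :: "'a \<Rightarrow> real"
  assumes "finite I" "card I = s + d"
  shows "\<exists>U\<subseteq>I. card U = s \<and> real s * sum r I \<le> real (card I) * sum r U"
  using assms
proof (induction d arbitrary: I)
  case 0
  then show ?case by (intro exI[of _ I]) simp
next
  case (Suc d)
  then have "I \<noteq> {}" by auto
  then obtain j where j: "j \<in> I" "\<And>i. i \<in> I \<Longrightarrow> r j \<le> r i"
    using ex_min_if_finite[of "r ` I"] Suc.prems(1) by (metis (no_types, lifting) arg_min_if_finite linorder_le_less_linear)
  define J where "J = I - {j}"
  have J: "finite J" "card J = s + d" using Suc.prems j by (simp_all add: J_def)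
  obtain U where U: "U \<subseteq> J" "card U = s" "real s * sum r J \<le> real (card J) * sum r U"
    using Suc.IH[OF J] by auto
  have "real (card U) * r j \<le> sum r U"
    by (rule sum_bounded_below) (use U j in \<open>auto simp: J_def\<close>)
  moreover have "sum r I = r j + sum r J" using Suc.prems j by (simp add: J_def sum.remove)
  ultimately have "real s * sum r I \<le> real (card I) * sum r U"
    using U(2,3) J(2) Suc.prems(2) by (simp add: algebra_simps)
  then show ?case using U by (auto simp: J_def)
qed

text \<open>If the \<open>s\<close> entries with the largest fractional parts are rounded up, the others lose in
  total at most \<open>s - s\<^sup>2 / card I\<close>.\<close>

lemma largest_remainder_rounding:
  fixes x :: "'a \<Rightarrow> real"
  assumes fin: "finite I" and nonneg: "\<And>i. i \<in> I \<Longrightarrow> 0 \<le> x i" and sum: "sum x I = real n"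
  shows "\<exists>k. sum k I = n \<and> (\<forall>i\<in>I. \<bar>x i - real (k i)\<bar> \<le> 1) \<and> (\<forall>i\<in>I. nat \<lfloor>x i\<rfloor> \<le> k i)
    \<and> (\<Sum>i\<in>I. max 0 (x i - real (k i))) \<le> real (card I) / 4"
proof (cases "I = {}")
  case False
  define fl where "fl i = nat \<lfloor>x i\<rfloor>" for i
  define r where "r i = x i - real (fl i)" for i
  have r: "0 \<le> r i" "r i \<le> 1" if "i \<in> I" for i
    using nonneg[OF that] by (auto simp: r_def fl_def) linarith+
  have sr: "sum r I = real n - real (sum fl I)" by (simp add: r_def sum_subtractf sum)
  have "0 \<le> sum r I" using r by (intro sum_nonneg) auto
  then have le: "sum fl I \<le> n" using sr by linarith
  define s where "s = n - sum fl I"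
  have s: "sum r I = real s" using sr le by (simp add: s_def of_nat_diff)
  have "sum r I \<le> real (card I) * 1" using r by (intro sum_bounded_above) auto
  then have "s \<le> card I" using s by simp
  then have "card I = s + (card I - s)" by simp
  then obtain U where U: "U \<subseteq> I" "card U = s" "real s * sum r I \<le> real (card I) * sum r U"
    using top_subset_exists[OF fin, of s _ r] by metis
  define k where "k i = fl i + of_bool (i \<in> U)" for i
  have "sum k I = sum fl I + card U" 
    using U fin by (simp add: k_def sum.distrib Int_absorb1 flip: Int_def)
  then have 1: "sum k I = n" using U le by (simp add: s_def)
  have 2: "\<bar>x i - real (k i)\<bar> \<le> 1" if "i \<in> I" for i
    using r[OF that] by (auto simp: k_def r_def)
  have "(\<Sum>i\<in>I. max 0 (x i - real (k i))) = (\<Sum>i\<in>I. r i - (if i \<in> U then r i else 0))"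
  proof (intro sum.cong refl)
    fix i assume "i \<in> I"
    then show "max 0 (x i - real (k i)) = r i - (if i \<in> U then r i else 0)"
      using r[of i] by (auto simp: k_def r_def max_def)
  qed
  also have "\<dots> = real s - sum r U"
    using U fin by (simp add: sum_subtractf s Int_absorb1 flip: sum.inter_restrict)
  also have "\<dots> \<le> real (card I) / 4"
  proof -
    define c where "c = real (card I)"
    have c: "c > 0" using False fin by (simp add: c_def card_gt_0_iff)
    \<comment> \<open>Source of the quarter: s (c - s) <= c^2 / 4.\<close>
    have "0 \<le> (real s - c / 2) * (real s - c / 2)" by simp
    then have "real s * c - real s * real s \<le> c * (c / 4)" by (simp add: algebra_simps)
    moreover have "real s * real s \<le> c * sum r U" using U(3) s by (simp add: c_def)
    ultimately have "c * (real s - sum r U) \<le> c * (c / 4)" by (simp add: algebra_simps)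
    then show ?thesis using c by (simp add: c_def)
  qed
  finally have 3: "(\<Sum>i\<in>I. max 0 (x i - real (k i))) \<le> real (card I) / 4" .
  have 4: "\<forall>i\<in>I. nat \<lfloor>x i\<rfloor> \<le> k i" by (simp add: k_def fl_def)
  show ?thesis using 1 2 3 4 by blast
qed (use sum in simp)

text \<open>Two reals with an integer sum have opposite distances to their nearest integers, so
  rounding one to the nearest rounds the other as well, and the error is 1/2 instead of 1.\<close>

lemma two_point_rounding:
  fixes x :: "'a \<Rightarrow> real"
  assumes I: "card I = 2" and half: "\<And>i. i \<in> I \<Longrightarrow> 1 / 2 \<le> x i" and sum: "sum x I = real n" and n: "n \<ge> 2"
  shows "\<exists>k. sum k I = n \<and> (\<forall>i\<in>I. \<bar>x i - real (k i)\<bar> \<le> 1 / 2) \<and> (\<forall>i\<in>I. 1 \<le> k i)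
    \<and> (\<Sum>i\<in>I. max 0 (x i - real (k i))) \<le> real (card I) / 4"
proof -
  obtain a b where ab: "I = {a, b}" "a \<noteq> b" "x a \<le> x b"
    using I by (metis card_2_iff insert_commute linorder_linear)
  have xab: "x a + x b = real n" using sum ab by simp
  define j where "j = nat \<lfloor>x a + 1 / 2\<rfloor>"
  have j: "real j \<le> x a + 1 / 2" "x a + 1 / 2 < real j + 1" 
    using half[of a] ab unfolding j_def by simp_all
  then have "j \<ge> 1" using half[of a] ab by simp
  \<comment> \<open>As \<open>a\<close> carries the smaller entry, j <= (n + 1)/2 <= n - 1/2 for n
    >= 2, which leaves at least one ball for \<open>b\<close>.\<close>
  have jn: "real j \<le> real n - 1 / 2" using j xab ab(3) n by simp
  then have "j < n" by linarith
  define k where "k i = (if i = a then j else n - j)" for i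
  have k: "k a = j" "k b = n - j" "real (n - j) = real n - real j" using ab \<open>j < n\<close> by (auto simp: k_def of_nat_diff)
  have "sum k I = n" using ab k \<open>j < n\<close> by simp
  moreover have "\<bar>x a - real (k a)\<bar> \<le> 1 / 2" using j unfolding k(1) by linarith
  moreover have "\<bar>x b - real (k b)\<bar> \<le> 1 / 2" using j xab unfolding k(2,3) by linarith
  moreover have "\<forall>i\<in>I. 1 \<le> k i" using ab k \<open>1 \<le> j\<close> \<open>j < n\<close> by auto
  moreover have "(\<Sum>i\<in>I. max 0 (x i - real (k i))) \<le> 1 / 2"
  proof -
    have "max 0 (x a - real j) + max 0 (x b - (real n - real j)) \<le> 1 / 2" using j xab by linarith
    then show ?thesis using ab k by simp
  qed
  ultimately show ?thesis using I ab by (intro exI[of _ k]) auto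
qed

text \<open>Concavity of -x ln x at q_i bounds the loss at i by (q_i - p_i) + (p_i - q_i) (- ln
  q_i). The first part sums to 0, and as - ln q_i >= 0 only entries that were decreased count in the
  second.\<close>

lemma entropy_loss:
  fixes p q :: "'a \<Rightarrow> real" and N :: real
  assumes fin: "finite I" and N: "N \<ge> 1"
    and p: "\<And>i. i \<in> I \<Longrightarrow> 0 < p i" and q: "\<And>i. i \<in> I \<Longrightarrow> 1 / N \<le> q i"
    and sums: "sum p I = 1" "sum q I = 1"
    and diff: "\<And>i. i \<in> I \<Longrightarrow> p i - q i \<le> 1 / N"
    and D: "(\<Sum>i\<in>I. max 0 (p i - q i)) \<le> real (card I) / (4 * N)"
  shows "(\<Sum>i\<in>I. q i * ln (q i)) - (\<Sum>i\<in>I. p i * ln (p i)) \<le> real (card I) / (4 * N) * ln (4 * N)"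
proof -
  define d where "d i = max 0 (p i - q i)" for i
  define l where "l = ln (4 * N)"
  have l: "l \<ge> 1" unfolding l_def using N exp_le by (subst ln_ge_iff) linarith+
  have "q i * ln (q i) - p i * ln (p i) \<le> (q i - p i) + 1 / (4 * N) + d i * (l - 1)" if i: "i \<in> I" for i
  proof -
    have N0: "0 < 1 / N" using N by simp
    have qp: "0 < q i" "0 < p i" using p[OF i] q[OF i] N0 by linarith+
    have "q i \<le> sum q I"
      using fin i q N0 by (intro member_le_sum) (auto intro: order_trans[OF less_imp_le[OF N0]])
    then have lnq: "ln (q i) \<le> 0" using sums qp by (simp add: ln_le_zero_iff)
    have "p i * ln (q i / p i) \<le> p i * (q i / p i - 1)"
      using qp ln_le_minus_one[of "q i / p i"] by (intro mult_left_mono) auto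
    then have 1: "p i * ln (q i) - p i * ln (p i) \<le> q i - p i" 
      using qp by (simp add: ln_div algebra_simps)
    have "(p i - q i) * - ln (q i) \<le> d i * - ln (q i)" 
      using lnq by (intro mult_right_mono) (auto simp: d_def)
    \<comment> \<open>Tangent of the logarithm at 1 / (4 N). Since d_i <= 1/N <= q_i, its linear
      term costs at most 1 / (4 N) per index, which the -1 compensates when \<open>D\<close> is
      inserted.\<close>
    also have "\<dots> \<le> d i * (1 / (4 * N * q i) - 1 + l)"
    proof (intro mult_left_mono)
      have "ln (1 / (4 * N * q i)) \<le> 1 / (4 * N * q i) - 1" using N qp by (intro ln_le_minus_one) simp
      moreover have "ln (1 / (4 * N * q i)) = - l - ln (q i)"
        using N qp by (simp add: ln_div ln_mult l_def)
      ultimately show "- ln (q i) \<le> 1 / (4 * N * q i) - 1 + l" by linarith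
    qed (simp add: d_def)
    also have "\<dots> = d i / q i * (1 / (4 * N)) + d i * (l - 1)" by (simp add: algebra_simps)
    also have "\<dots> \<le> 1 * (1 / (4 * N)) + d i * (l - 1)"
    proof (intro add_right_mono mult_right_mono)
      have "d i \<le> q i" using diff[OF i] q[OF i] qp by (auto simp: d_def)
      then show "d i / q i \<le> 1" using qp by simp
    qed (use N in simp)
    finally show ?thesis using 1 by (simp add: algebra_simps)
  qed
  then have "(\<Sum>i\<in>I. q i * ln (q i) - p i * ln (p i)) \<le> (\<Sum>i\<in>I. (q i - p i) + 1 / (4 * N) + d i * (l - 1))"
    by (rule sum_mono)
  also have "\<dots> = (sum q I - sum p I) + real (card I) * (1 / (4 * N)) + sum d I * (l - 1)"
    by (simp only: sum.distrib sum_subtractf sum_constant sum_distrib_right)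
  also have "\<dots> \<le> real (card I) / (4 * N) + real (card I) / (4 * N) * (l - 1)"
    using sums mult_right_mono[OF D, of "l - 1"] l by (simp add: d_def)
  also have "\<dots> = real (card I) / (4 * N) * l" using N by (simp add: field_simps)
  finally show ?thesis by (simp add: sum_subtractf l_def)
qed

text \<open>Stirling's formula from below for n! and from above for each non-zero count; the error
  terms 1 / (12 k_i) <= 1/12 explain the 1/12 in \<open>C2\<close>.\<close>

lemma ln_num_realizations_ge:
  fixes k :: "'m::finite \<Rightarrow> nat"
  assumes n: "n \<ge> 1" and k: "k \<in> comps UNIV n"
  defines "\<mu> \<equiv> real (card {i. k i \<noteq> 0})"
  shows "real n * entropy (freq_of n k) + ln (2 * pi * real n) / 2
      - \<mu> / 2 * (ln (2 * pi) + ln (real n) - ln \<mu>) - \<mu> / 12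
    \<le> ln (num_realizations n (freq_of n k))"
proof -
  define I where "I = {i. k i \<noteq> 0}"
  have "I \<noteq> {}"
  proof
    assume "I = {}"
    then have "\<forall>i. k i = 0" by (auto simp: I_def)
    then show False using k n by (simp add: comps_def)
  qed
  then have I: "finite I" "I \<noteq> {}" and \<mu>: "\<mu> = real (card I)" by (simp_all add: I_def \<mu>_def)
  then have \<mu>0: "\<mu> > 0" by (simp add: card_gt_0_iff)
  have restrict: "sum g UNIV = sum g I" if "\<And>i. k i = 0 \<Longrightarrow> g i = 0" for g :: "'m \<Rightarrow> real"
    using that by (intro sum.mono_neutral_right) (auto simp: I_def)
  have sumk: "(\<Sum>i\<in>I. real (k i)) = real n"
    using k restrict[of "\<lambda>i. real (k i)"] by (simp add: comps_def flip: of_nat_sum)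
  have "real n * entropy (freq_of n k) = - (\<Sum>i\<in>I. real (k i) * ln (real (k i) / real n))"
    using n by (subst restrict[symmetric]) (auto simp: entropy_def freq_of_def sum_distrib_left sum_negf)
  also have "\<dots> = - (\<Sum>i\<in>I. real (k i) * ln (real (k i)) - real (k i) * ln (real n))"
    using n by (intro arg_cong[of _ _ uminus] sum.cong) (auto simp: ln_div I_def algebra_simps)
  also have "\<dots> = real n * ln (real n) - (\<Sum>i\<in>I. real (k i) * ln (real (k i)))"
    by (simp add: sum_subtractf sumk flip: sum_distrib_right)
  finally have H: "real n * entropy (freq_of n k) = real n * ln (real n) - (\<Sum>i\<in>I. real (k i) * ln (real (k i)))" .
  have "(\<Sum>i\<in>UNIV. ln (fact (k i))) = (\<Sum>i\<in>I. ln (fact (k i) :: real))" by (rule restrict) simp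
  also have "\<dots> \<le> (\<Sum>i\<in>I. real (k i) * ln (real (k i)) - real (k i)
      + (ln (2 * pi) + (ln (real n / \<mu>) + (real (k i) / (real n / \<mu>) - 1))) / 2 + 1 / 12)"
  proof (intro sum_mono)
    fix i assume "i \<in> I"
    then have ki: "k i \<ge> 1" by (simp add: I_def)
    \<comment> \<open>Tangent at the mean n / \<mu> of the non-zero counts: its linear terms cancel
      in the sum, which amounts to Jensen's inequality.\<close>
    have "ln (real (k i)) \<le> ln (real n / \<mu>) + (real (k i) / (real n / \<mu>) - 1)"
      using ki n \<mu>0 by (intro ln_le_tangent) auto
    moreover have "ln (2 * pi * real (k i)) = ln (2 * pi) + ln (real (k i))"
      using ki by (simp add: ln_mult)
    moreover have "1 / (12 * real (k i)) \<le> 1 / 12" using ki by (simp add: divide_simps)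
    ultimately show "ln (fact (k i)) \<le> real (k i) * ln (real (k i)) - real (k i)
      + (ln (2 * pi) + (ln (real n / \<mu>) + (real (k i) / (real n / \<mu>) - 1))) / 2 + 1 / 12"
      using ln_fact_bounds(2)[OF ki] by argo
  qed
  also have "\<dots> = (\<Sum>i\<in>I. real (k i) * ln (real (k i))) - real n
      + (\<mu> * ln (2 * pi) + (\<mu> * ln (real n / \<mu>) + (real n / (real n / \<mu>) - \<mu>))) / 2 + \<mu> / 12"
    by (simp only: sum.distrib sum_subtractf sum_constant sumk \<mu>[symmetric] flip: sum_divide_distrib) simp
  also have "\<dots> = (\<Sum>i\<in>I. real (k i) * ln (real (k i))) - real n
      + \<mu> / 2 * (ln (2 * pi) + ln (real n) - ln \<mu>) + \<mu> / 12"
    using n \<mu>0 by (simp add: ln_div field_simps)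
  finally have "(\<Sum>i\<in>UNIV. ln (fact (k i) :: real)) \<le> \<dots>" .
  moreover have "ln (num_realizations n (freq_of n k)) = ln (fact n) - (\<Sum>i\<in>UNIV. ln (fact (k i)))"
    using n by (simp add: num_realizations_freq_of ln_div ln_prod)
  ultimately show ?thesis using H ln_fact_bounds(1)[OF n] by argo
qed


section \<open>Constraints and entropy\<close>

text \<open>Hoelder's inequality for the l1 norm of a row and the maximum norm of f - \<phi>. The
  case of a zero matrix is separate, because there the ratio is \<infinity>.\<close>

lemma row_close:
  assumes "a \<in> set A" "0 \<le> c" "0 \<le> \<theta>" "ereal \<theta> \<le> tol_ratio c A" "\<And>i. \<bar>f $ i - \<phi> $ i\<bar> \<le> \<theta>"
  shows "\<bar>a \<bullet> f - a \<bullet> \<phi>\<bar> \<le> c"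
proof -
  define M where "M = mat_norm_inf A"
  have aM: "(\<Sum>i\<in>UNIV. \<bar>a $ i\<bar>) \<le> M"
    unfolding M_def mat_norm_inf_def using assms(1) by (intro Max_ge) auto
  have "\<bar>a \<bullet> f - a \<bullet> \<phi>\<bar> = \<bar>\<Sum>i\<in>UNIV. a $ i * (f $ i - \<phi> $ i)\<bar>"
    by (simp add: inner_vec_def sum_subtractf right_diff_distrib)
  also have "\<dots> \<le> (\<Sum>i\<in>UNIV. \<bar>a $ i\<bar> * \<theta>)"
    by (rule order_trans[OF sum_abs]) (auto simp: abs_mult intro!: sum_mono mult_left_mono assms(5))
  also have "\<dots> \<le> M * \<theta>" using aM assms(3) by (simp add: mult_right_mono flip: sum_distrib_right)
  also have "\<dots> \<le> c"
  proof (cases "M = 0")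
    case False
    moreover have "0 \<le> M" using aM by (rule order_trans[rotated]) (simp add: sum_nonneg)
    ultimately have M: "M > 0" by simp
    have "A \<noteq> []" using assms(1) by auto
    then have "tol_ratio c A = ereal (c / M)" using M unfolding tol_ratio_def M_def by simp
    then have "ereal \<theta> \<le> ereal (c / M)" using assms(4) by simp
    then show ?thesis using M by (simp add: field_simps)
  qed (use assms in simp)
  finally show ?thesis .
qed

lemma tol_ratio_pos:
  assumes "A \<noteq> [] \<Longrightarrow> 0 < c"
  shows "0 < tol_ratio c A"
proof (cases "A = []")
  case False
  define M where "M = mat_norm_inf A"
  obtain a where a: "a \<in> set A" using False by (meson hd_in_set)
  have "0 \<le> (\<Sum>i\<in>UNIV. \<bar>a $ i\<bar>)" by (simp add: sum_nonneg)
  also have "\<dots> \<le> M" unfolding M_def mat_norm_inf_def using a by (intro Max_ge) auto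
  finally show ?thesis using assms[OF False] False
    by (cases "M = 0") (auto simp: tol_ratio_def M_def[symmetric])
qed (simp add: tol_ratio_def)

lemma abs_min_pos: "b \<noteq> [] \<Longrightarrow> 0 \<notin> set b \<Longrightarrow> 0 < abs_min b"
  unfolding abs_min_def by (subst Min_gr_iff) auto

lemma tolerance_pos:
  assumes "wf_constraints K" "pos_tolerances d"
  shows "Aeq K \<noteq> [] \<Longrightarrow> 0 < tol_eq d * abs_min (beq K)"
    and "Ale K \<noteq> [] \<Longrightarrow> 0 < tol_le d * abs_min (ble K)"
  using assms by (auto simp: wf_constraints_def pos_tolerances_def intro!: mult_pos_pos abs_min_pos)

lemma theta_inf_pos:
  assumes "wf_constraints K" "pos_tolerances d"
  shows "0 < theta_inf K d"
  using assms(2) unfolding theta_inf_def pos_tolerances_def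
  by (subst Min_gr_iff) (auto intro!: tol_ratio_pos tolerance_pos[OF assms])

lemma relaxed_if_close:
  assumes wf: "wf_constraints K" and pos: "pos_tolerances d" and \<phi>: "\<phi> \<in> polytope_of K"
    and \<theta>: "0 \<le> \<theta>" "ereal \<theta> \<le> theta_inf K d" and close: "\<And>i. \<bar>f $ i - \<phi> $ i\<bar> \<le> \<theta>"
  shows "f \<in> relaxed K d"
proof -
  have le: "ereal \<theta> \<le> tol_ratio (tol_eq d * abs_min (beq K)) (Aeq K)"
    "ereal \<theta> \<le> tol_ratio (tol_le d * abs_min (ble K)) (Ale K)"
    "ereal \<theta> \<le> tol_ratio (tol_eq0 d) (Aeq0 K)" "ereal \<theta> \<le> tol_ratio (tol_le0 d) (Ale0 K)"
    using \<theta>(2) unfolding theta_inf_def by (auto simp: Min_ge_iff)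
  note row = row_close[OF _ _ \<theta>(1) _ close]
  have r1: "\<bar>a \<bullet> f - a \<bullet> \<phi>\<bar> \<le> tol_eq d * abs_min (beq K)" if "a \<in> set (Aeq K)" for a
  proof -
    have "Aeq K \<noteq> []" using that by auto
    then show ?thesis using row[OF that less_imp_le[OF tolerance_pos(1)[OF wf pos]] le(1)] by blast
  qed
  have r2: "\<bar>a \<bullet> f - a \<bullet> \<phi>\<bar> \<le> tol_le d * abs_min (ble K)" if "a \<in> set (Ale K)" for a
  proof -
    have "Ale K \<noteq> []" using that by auto
    then show ?thesis using row[OF that less_imp_le[OF tolerance_pos(2)[OF wf pos]] le(2)] by blast
  qed
  have r3: "\<bar>a \<bullet> f - a \<bullet> \<phi>\<bar> \<le> tol_eq0 d" if "a \<in> set (Aeq0 K)" for a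
    using row[OF that _ le(3)] pos by (auto simp: pos_tolerances_def)
  have r4: "\<bar>a \<bullet> f - a \<bullet> \<phi>\<bar> \<le> tol_le0 d" if "a \<in> set (Ale0 K)" for a
    using row[OF that _ le(4)] pos by (auto simp: pos_tolerances_def)
  have P: "map (\<lambda>a. a \<bullet> \<phi>) (Aeq K) = beq K" "list_all2 (\<le>) (map (\<lambda>a. a \<bullet> \<phi>) (Ale K)) (ble K)"
    "map (\<lambda>a. a \<bullet> \<phi>) (Aeq0 K) = replicate (length (Aeq0 K)) 0"
    "list_all2 (\<le>) (map (\<lambda>a. a \<bullet> \<phi>) (Ale0 K)) (replicate (length (Ale0 K)) 0)"
    using \<phi> by (simp_all add: polytope_of_def mat_vec_def vec_le_def)
  \<comment> \<open>The row-wise change serves as the perturbation \<beta> in both categories with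
    non-zero right-hand side.\<close>
  let ?D = "map (\<lambda>a. a \<bullet> f - a \<bullet> \<phi>)"
  have "length (?D (Aeq K)) = length (beq K) \<and> linf_le (?D (Aeq K)) (tol_eq d * abs_min (beq K)) \<and>
      mat_vec (Aeq K) f = vec_add (beq K) (?D (Aeq K))"
  proof (intro conjI)
    show "length (?D (Aeq K)) = length (beq K)" unfolding P(1)[symmetric] by simp
    show "linf_le (?D (Aeq K)) (tol_eq d * abs_min (beq K))" using r1 by (auto simp: linf_le_def)
    have "mat_vec (Aeq K) f = vec_add (map (\<lambda>a. a \<bullet> \<phi>) (Aeq K)) (?D (Aeq K))"
      by (simp add: mat_vec_def vec_add_def map2_map_map)
    then show "mat_vec (Aeq K) f = vec_add (beq K) (?D (Aeq K))" by (simp only: P(1))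
  qed
  moreover have "length (?D (Ale K)) = length (ble K) \<and> linf_le (?D (Ale K)) (tol_le d * abs_min (ble K)) \<and>
      vec_le (mat_vec (Ale K) f) (vec_add (ble K) (?D (Ale K)))"
    using r2 P(2) by (auto simp: linf_le_def mat_vec_def vec_add_def vec_le_def list_all2_conv_all_nth)
  moreover have "linf_le (mat_vec (Aeq0 K) f) (tol_eq0 d)"
  proof -
    have "a \<bullet> \<phi> = 0" if "a \<in> set (Aeq0 K)" for a
      using that P(3) by (metis (no_types, lifting) image_eqI in_set_replicate list.set_map)
    then show ?thesis using r3 by (auto simp: linf_le_def mat_vec_def)
  qed
  moreover have "linf_le (replicate (length (Ale0 K)) (tol_le0 d)) (tol_le0 d) \<and>
      vec_le (mat_vec (Ale0 K) f) (replicate (length (Ale0 K)) (tol_le0 d))"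
  proof -
    have "a \<bullet> f \<le> tol_le0 d" if "a \<in> set (Ale0 K)" for a
    proof -
      have "a \<bullet> \<phi> \<le> 0" using that P(4) by (auto simp: list_all2_conv_all_nth in_set_conv_nth)
      then show ?thesis using r4[OF that] by linarith
    qed
    then show ?thesis using pos
      by (auto simp: linf_le_def mat_vec_def vec_le_def list_all2_conv_all_nth pos_tolerances_def)
  qed
  ultimately show ?thesis unfolding relaxed_def by blast
qed

text \<open>Links the equation for \<alpha> to the closed form of N: reciprocals exchange minimum
  and maximum, also for \<theta> = \<infinity> with 1 / \<theta> = 0.\<close>

lemma threshold_reciprocal:
  fixes \<theta> :: ereal and b c k M :: real
  assumes "0 < \<theta>" "0 < b" "0 < c" "0 < k" "0 < M"
  shows "ereal M / (ereal k * Min {\<theta>, ereal b, ereal c}) = ereal (M / k) * Max {ereal (1 / b), 1 / \<theta>, 1 / ereal c}"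
proof (cases \<theta>)
  case (real r)
  then have r: "r > 0" using assms by simp
  define w where "w = min r (min b c)"
  have w: "w > 0" using r assms by (simp add: w_def)
  have min: "Min {\<theta>, ereal b, ereal c} = ereal w"
    using real by (simp add: min_def w_def)
  have max: "Max {ereal (1 / b), 1 / \<theta>, 1 / ereal c} = ereal (1 / w)"
    using real r assms by (auto simp: max_def min_def divide_simps one_ereal_def w_def)
  show ?thesis unfolding min max using w assms by simp
next
  case PInf
  define w where "w = min b c"
  have w: "w > 0" using assms by (simp add: w_def)
  have min: "Min {\<theta>, ereal b, ereal c} = ereal w"
    using PInf by (simp add: min_def w_def)
  have max: "Max {ereal (1 / b), 1 / \<theta>, 1 / ereal c} = ereal (1 / w)"
    using PInf assms by (auto simp: max_def min_def divide_simps one_ereal_def zero_ereal_def w_def)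
  show ?thesis unfolding min max using w assms by simp
qed (use assms in simp)

lemma entropy_lt_card:
  fixes x :: "real^'m::finite"
  assumes "x \<in> prob_simplex"
  shows "entropy x < real CARD('m)"
proof -
  have "- (x $ i * ln (x $ i)) \<le> 1 - x $ i" for i
  proof (cases "x $ i = 0")
    case False
    then have "x $ i > 0" using assms by (simp add: prob_simplex_def less_le)
    then have "x $ i * ln (1 / x $ i) \<le> x $ i * (1 / x $ i - 1)"
      by (intro mult_left_mono ln_le_minus_one) auto
    then show ?thesis using \<open>x $ i > 0\<close> by (simp add: ln_div algebra_simps)
  qed simp
  then have "entropy x \<le> (\<Sum>i\<in>UNIV. 1 - x $ i)"
    unfolding entropy_def sum_negf[symmetric] by (rule sum_mono)
  also have "\<dots> = real CARD('m) - 1" using assms by (simp add: sum_subtractf prob_simplex_def)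
  finally show ?thesis by simp
qed

lemma two_le_num_nonzero:
  assumes "x \<in> prob_simplex" "0 < entropy x"
  shows "2 \<le> num_nonzero x"
proof (rule ccontr)
  assume "\<not> 2 \<le> num_nonzero x"
  define I where "I = {i. x $ i \<noteq> 0}"
  have "card I \<le> 1" using \<open>\<not> 2 \<le> num_nonzero x\<close> by (simp add: num_nonzero_def I_def)
  then obtain j where j: "I \<subseteq> {j}" by (metis One_nat_def card_le_Suc0_iff_eq finite subsetI singletonI empty_subsetI insert_subset subset_singletonD all_not_in_conv insert_iff)
  then have x: "x $ i = 0" if "i \<noteq> j" for i using that by (auto simp: I_def)
  have "(\<Sum>i\<in>UNIV. x $ i) = (\<Sum>i\<in>{j}. x $ i)" using x by (intro sum.mono_neutral_right) auto
  then have "x $ j = 1" using assms by (simp add: prob_simplex_def)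
  moreover have "(\<Sum>i\<in>UNIV. x $ i * ln (x $ i)) = (\<Sum>i\<in>{j}. x $ i * ln (x $ i))"
    using x by (intro sum.mono_neutral_right) auto
  ultimately show False using assms by (simp add: entropy_def)
qed

lemma freqs_subset_prob_simplex:
  assumes "n > 0"
  shows "freqs n \<subseteq> prob_simplex"
proof
  fix f :: "real^'m" assume "f \<in> freqs n"
  then obtain \<nu> where \<nu>: "(\<Sum>i\<in>UNIV. \<nu> i) = n" "\<And>i. f $ i = real (\<nu> i) / real n"
    by (auto simp: freqs_def)
  have "(\<Sum>i\<in>UNIV. f $ i) = real (\<Sum>i\<in>UNIV. \<nu> i) / real n"
    by (simp add: \<nu>(2) sum_divide_distrib)
  then show "f \<in> prob_simplex" using \<nu> assms by (simp add: prob_simplex_def)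
qed

lemma entropy_nonneg:
  assumes "x \<in> prob_simplex"
  shows "0 \<le> entropy x"
proof -
  have x: "0 \<le> x $ i" "x $ i \<le> 1" for i
    using assms member_le_sum[of i UNIV "\<lambda>i. x $ i"] by (auto simp: prob_simplex_def)
  have "x $ i * ln (x $ i) \<le> 0" for i
    using x[of i] by (cases "x $ i = 0") (auto intro!: mult_nonneg_nonpos simp: ln_le_zero_iff)
  then show ?thesis by (simp add: entropy_def sum_nonpos)
qed

lemma num_realizations_pos: "0 < num_realizations n f"
  by (simp add: num_realizations_def prod_pos)

text \<open>A Markov-type bound: the factor exp (n (h - H(f))) is at least 1 on \<open>S\<close>;
  once it is inserted, the sum may run over all frequency vectors.\<close>

lemma num_realizations_set_low_entropy_le:
  fixes S :: "(real^'m::finite) set"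
  assumes "n > 0" "S \<subseteq> freqs n" "\<And>f. f \<in> S \<Longrightarrow> entropy f \<le> h"
  shows "num_realizations_set n S \<le> exp (real n * h) * shtarkov n CARD('m)"
proof -
  have "num_realizations_set n S \<le> (\<Sum>f\<in>S. exp (real n * h) * (num_realizations n f * exp (- (real n * entropy f))))"
    unfolding num_realizations_set_def
  proof (intro sum_mono)
    fix f assume "f \<in> S"
    then have "1 \<le> exp (real n * h) * exp (- (real n * entropy f))"
      using assms(3) by (simp add: mult_left_mono flip: exp_add)
    then have "num_realizations n f * 1 \<le> num_realizations n f * (exp (real n * h) * exp (- (real n * entropy f)))"
      using num_realizations_pos[of n f] by (intro mult_left_mono) auto
    then show "num_realizations n f \<le> exp (real n * h) * (num_realizations n f * exp (- (real n * entropy f)))"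
      by (simp add: mult_ac)
  qed
  also have "\<dots> \<le> exp (real n * h) * (\<Sum>f\<in>(freqs n :: (real^'m) set). num_realizations n f * exp (- (real n * entropy f)))"
    unfolding sum_distrib_left[symmetric]
    by (intro mult_left_mono sum_mono2[OF finite_freqs assms(2)])
      (auto intro!: mult_nonneg_nonneg less_imp_le[OF num_realizations_pos])
  finally show ?thesis using sum_freqs_shtarkov[OF assms(1), where 'm = 'm] by simp
qed

text \<open>With l = ln (4 n), failure would give m / t >= 4 n / l, hence ln (m / t) >= l - ln l >=
  2 l / 3. The factor 3/2 in the threshold cancels this 2/3 and leaves n t >= c0 l >= \<mu> l / 4,
  the opposite of the failure.\<close>

lemma entropy_tolerance_ge:
  fixes c0 m \<mu> t :: real and n :: nat
  assumes n: "100 \<le> n" and t: "0 < t" "t < m" and \<mu>: "0 < \<mu>" "\<mu> \<le> m" "\<mu> / 4 \<le> c0"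
    and le: "c0 * (3 * ln (m / t) / (2 * t)) \<le> real n"
  shows "\<mu> / (4 * real n) * ln (4 * real n) \<le> t"
proof (rule ccontr)
  assume neg: "\<not> ?thesis"
  define l where "l = ln (4 * real n)"
  have l: "5 \<le> l" "ln l \<le> l / 3" unfolding l_def using ln_ln_le[of "4 * real n"] n by auto
  have n0: "real n > 0" using n by simp
  have tl: "t < \<mu> / (4 * real n) * l" using neg by (simp add: l_def)
  have "4 * real n / l \<le> m / t"
  proof -
    have "4 * real n * t \<le> \<mu> * l" using tl n0 by (simp add: field_simps)
    also have "\<dots> \<le> m * l" using \<mu> l by (intro mult_right_mono) auto
    finally show ?thesis using t l by (simp add: field_simps)
  qed
  then have "ln (4 * real n / l) \<le> ln (m / t)" using l n0 by (intro ln_mono) auto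
  then have "2 / 3 * l \<le> ln (m / t)" using l n0 by (simp add: ln_div l_def)
  moreover have "c0 > 0" using \<mu> by simp
  ultimately have "c0 * (3 * (2 / 3 * l) / (2 * t)) \<le> c0 * (3 * ln (m / t) / (2 * t))"
    using t by (intro mult_left_mono divide_right_mono) auto
  then have "c0 * l \<le> real n * t" using le t by (simp add: field_simps)
  moreover have "\<mu> / 4 * l \<le> c0 * l" using \<mu> l by (intro mult_right_mono) auto
  ultimately show False using tl n0 by (simp add: field_simps)
qed

lemma ratio_ge:
  fixes g b \<epsilon> :: real
  assumes "0 < g" "0 \<le> b" "0 < \<epsilon>" "b * (1 / \<epsilon> + 1) \<le> g"
  shows "1 - \<epsilon> \<le> g / (g + b)"
proof -
  have "b + \<epsilon> * b = \<epsilon> * (b * (1 / \<epsilon> + 1))" using assms by (simp add: field_simps)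
  also have "\<dots> \<le> \<epsilon> * g" using assms by (intro mult_left_mono) auto
  finally have "(1 - \<epsilon>) * (g + b) \<le> g" using assms by (simp add: algebra_simps)
      (smt (verit) mult_nonneg_nonneg)
  then show ?thesis using assms by (simp add: pos_le_divide_eq)
qed

text \<open>Joins the 9.8 of \<open>shtarkov_le\<close>, the 0.249 of \<open>C2\<close> and
  Stirling's constant for n!: 9.8 * 0.249 = 2.4402 < sqrt 6 < sqrt (2 pi).\<close>

lemma ln_constants_le: "ln 9.8 + ln 0.249 \<le> ln (2 * pi) / 2"
proof -
  have "(9.8 * 0.249 :: real) \<le> sqrt 6" by (rule real_le_rsqrt) (simp add: power2_eq_square)
  also have "\<dots> \<le> sqrt (2 * pi)" using pi_gt3 by simp
  finally have "ln (9.8 * 0.249 :: real) \<le> ln (sqrt (2 * pi))" by (subst ln_le_cancel_iff) auto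
  moreover have "ln (9.8 * 0.249 :: real) = ln 9.8 + ln 0.249" by (rule ln_mult_pos) auto
  ultimately show ?thesis by (simp add: ln_sqrt)
qed


text \<open>The lower bound on \<open>min_nonzero\<close> keeps every non-zero entry at one ball or
  more, so the support, and with it \<mu>, is preserved.\<close>

lemma support_rounding:
  fixes \<phi> :: "real^'m::finite" and n :: nat
  defines "c0 \<equiv> (real CARD('m) - 1) / kappa \<phi>"
  assumes \<phi>: "\<phi> \<in> prob_simplex" and supp: "2 \<le> num_nonzero \<phi>" and n: "2 \<le> n"
    and min: "c0 \<le> real n * min_nonzero \<phi>"
  obtains k :: "'m \<Rightarrow> nat" where "k \<in> comps UNIV n" "{i. k i \<noteq> 0} = {i. \<phi> $ i \<noteq> 0}"
    "\<And>i. \<bar>freq_of n k $ i - \<phi> $ i\<bar> \<le> c0 / real n"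
    "entropy \<phi> - entropy (freq_of n k) \<le> real (num_nonzero \<phi>) / (4 * real n) * ln (4 * real n)"
proof -
  define I where "I = {i. \<phi> $ i \<noteq> 0}"
  define x where "x i = real n * \<phi> $ i" for i
  have I: "finite I" "card I = num_nonzero \<phi>" by (simp_all add: I_def num_nonzero_def)
  have nonneg: "0 \<le> \<phi> $ i" for i using \<phi> by (simp add: prob_simplex_def)
  have "(\<Sum>i\<in>I. \<phi> $ i) = (\<Sum>i\<in>UNIV. \<phi> $ i)" by (intro sum.mono_neutral_left) (auto simp: I_def)
  then have sum1: "(\<Sum>i\<in>I. \<phi> $ i) = 1" using \<phi> by (simp add: prob_simplex_def)
  then have sumx: "sum x I = real n" by (simp add: x_def flip: sum_distrib_left)
  have \<mu>m: "num_nonzero \<phi> \<le> CARD('m)" unfolding num_nonzero_def by (intro card_mono) auto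
  have xc0: "c0 \<le> x i" if "i \<in> I" for i
  proof -
    have "min_nonzero \<phi> \<le> \<phi> $ i"
      unfolding min_nonzero_def using that by (intro Min_le) (auto simp: I_def)
    then have "real n * min_nonzero \<phi> \<le> x i" by (simp add: x_def mult_left_mono)
    then show ?thesis using min by simp
  qed
  have "\<exists>k. sum k I = n \<and> (\<forall>i\<in>I. \<bar>x i - real (k i)\<bar> \<le> c0) \<and> (\<forall>i\<in>I. \<bar>x i - real (k i)\<bar> \<le> 1)
    \<and> (\<forall>i\<in>I. 1 \<le> k i) \<and> (\<Sum>i\<in>I. max 0 (x i - real (k i))) \<le> real (card I) / 4"
  \<comment> \<open>For m = 2 both entries are non-zero, so \<open>kappa\<close> is 2 and
    \<open>c0\<close> is 1/2; in all other cases \<open>c0 >= 1\<close> permits moves by a whole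
    unit.\<close>
  proof (cases "CARD('m) = 2")
    case True
    then have "num_nonzero \<phi> = 2" using supp \<mu>m by simp
    then have c0: "c0 = 1 / 2" and "card I = 2" using True I by (simp_all add: c0_def kappa_def)
    have half: "1 / 2 \<le> x i" if "i \<in> I" for i using xc0[OF that] c0 by simp
    obtain k where "sum k I = n" "\<forall>i\<in>I. \<bar>x i - real (k i)\<bar> \<le> 1 / 2" "\<forall>i\<in>I. 1 \<le> k i"
      "(\<Sum>i\<in>I. max 0 (x i - real (k i))) \<le> real (card I) / 4"
      using two_point_rounding[OF \<open>card I = 2\<close> half sumx n] by blast
    moreover from this have "\<forall>i\<in>I. \<bar>x i - real (k i)\<bar> \<le> 1" by force
    ultimately show ?thesis unfolding c0 by blast
  next
    case False
    then have c0: "1 \<le> c0" using supp \<mu>m by (auto simp: c0_def kappa_def)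
    have x0: "0 \<le> x i" for i using nonneg by (simp add: x_def)
    obtain k where k: "sum k I = n" "\<forall>i\<in>I. \<bar>x i - real (k i)\<bar> \<le> 1" "\<forall>i\<in>I. nat \<lfloor>x i\<rfloor> \<le> k i"
      "(\<Sum>i\<in>I. max 0 (x i - real (k i))) \<le> real (card I) / 4"
      using largest_remainder_rounding[of I x n] I x0 sumx by metis
    have "1 \<le> k i" if "i \<in> I" for i
    proof -
      have "1 \<le> \<lfloor>x i\<rfloor>" using xc0[OF that] c0 by (simp add: le_floor_iff)
      moreover have "nat \<lfloor>x i\<rfloor> \<le> k i" using k(3) that by blast
      ultimately show ?thesis by linarith
    qed
    then show ?thesis using k c0 by (intro exI[of _ k]) force
  qed
  then obtain k0 where k0: "sum k0 I = n" "\<And>i. i \<in> I \<Longrightarrow> \<bar>x i - real (k0 i)\<bar> \<le> c0"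
    "\<And>i. i \<in> I \<Longrightarrow> \<bar>x i - real (k0 i)\<bar> \<le> 1" "\<And>i. i \<in> I \<Longrightarrow> 1 \<le> k0 i"
    "(\<Sum>i\<in>I. max 0 (x i - real (k0 i))) \<le> real (card I) / 4" by blast
  define k where "k i = (if i \<in> I then k0 i else 0)" for i
  have kI: "sum k I = n" using k0(1) by (simp add: k_def)
  have "sum k UNIV = sum k I" by (intro sum.mono_neutral_right) (auto simp: k_def)
  then have comps: "k \<in> comps UNIV n" using kI by (simp add: comps_def)
  have supp_eq: "{i. k i \<noteq> 0} = I" using k0(4) by (force simp: k_def)
  have n0: "real n > 0" using n by simp
  have fx: "freq_of n k $ i - \<phi> $ i = - ((x i - real (k i)) / real n)" for i
    using n0 by (simp add: freq_of_def x_def field_simps)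
  have m2: "c0 \<ge> 0" using supp \<mu>m by (auto simp: c0_def kappa_def)
  have close: "\<bar>freq_of n k $ i - \<phi> $ i\<bar> \<le> c0 / real n" for i
  proof (cases "i \<in> I")
    case True
    then show ?thesis unfolding fx abs_minus_cancel abs_divide using k0(2)[OF True] n0
      by (auto simp: k_def intro: divide_right_mono)
  qed (use m2 n0 in \<open>simp add: freq_of_def k_def I_def\<close>)
  have "entropy \<phi> - entropy (freq_of n k)
      = (\<Sum>i\<in>I. freq_of n k $ i * ln (freq_of n k $ i)) - (\<Sum>i\<in>I. \<phi> $ i * ln (\<phi> $ i))"
  proof -
    have "(\<Sum>i\<in>UNIV. freq_of n k $ i * ln (freq_of n k $ i)) = (\<Sum>i\<in>I. freq_of n k $ i * ln (freq_of n k $ i))"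
      by (intro sum.mono_neutral_right) (auto simp: freq_of_def k_def)
    moreover have "(\<Sum>i\<in>UNIV. \<phi> $ i * ln (\<phi> $ i)) = (\<Sum>i\<in>I. \<phi> $ i * ln (\<phi> $ i))"
      by (intro sum.mono_neutral_right) (auto simp: I_def)
    ultimately show ?thesis by (simp add: entropy_def)
  qed
  also have "\<dots> \<le> real (card I) / (4 * real n) * ln (4 * real n)"
  proof (rule entropy_loss)
    show "0 < \<phi> $ i" if "i \<in> I" for i using that nonneg[of i] by (simp add: I_def less_le)
    show "1 / real n \<le> freq_of n k $ i" if "i \<in> I" for i
      using k0(4)[OF that] that n0 by (simp add: freq_of_def k_def divide_right_mono)
    show "(\<Sum>i\<in>I. freq_of n k $ i) = 1"
      using kI n0 by (simp add: freq_of_def flip: sum_divide_distrib of_nat_sum)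
    show "\<phi> $ i - freq_of n k $ i \<le> 1 / real n" if "i \<in> I" for i
    proof -
      have "\<phi> $ i - freq_of n k $ i = (x i - real (k i)) / real n" using fx[of i] by simp
      also have "\<dots> \<le> 1 / real n" using k0(3)[OF that] that n0 by (intro divide_right_mono) (auto simp: k_def)
      finally show ?thesis .
    qed
    have "max 0 (\<phi> $ i - freq_of n k $ i) = max 0 (x i - real (k0 i)) / real n" if "i \<in> I" for i
    proof -
      have "\<phi> $ i - freq_of n k $ i = (x i - real (k0 i)) / real n" using fx[of i] that by (simp add: k_def)
      then show ?thesis using n0 by (simp add: max_def divide_le_0_iff zero_le_divide_iff)
    qed
    then have "(\<Sum>i\<in>I. max 0 (\<phi> $ i - freq_of n k $ i)) = (\<Sum>i\<in>I. max 0 (x i - real (k0 i))) / real n"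
      by (simp add: sum_divide_distrib)
    also have "\<dots> \<le> real (card I) / 4 / real n" using k0(5) n0 by (intro divide_right_mono) auto
    finally show "(\<Sum>i\<in>I. max 0 (\<phi> $ i - freq_of n k $ i)) \<le> real (card I) / (4 * real n)" by simp
  qed (use I sum1 n in auto)
  finally show ?thesis using that[OF comps _ close] supp_eq I by (simp add: I_def)
qed

text \<open>The condition \<open>cov\<close> excludes the undefined branch of
  \<open>N_fun\<close>.\<close>

lemma N_fun_le_imp:
  fixes \<phi> :: "real^'m::finite"
  assumes c1: "0 < C1 \<phi> \<eta> \<alpha>" and cov: "\<not> (C2 \<phi> \<epsilon> \<eta> \<alpha> > 0 \<and> C1 \<phi> \<eta> \<alpha> + C2 \<phi> \<epsilon> \<eta> \<alpha> < 21)"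
    and n: "N_fun \<phi> \<epsilon> \<eta> \<alpha> \<le> x" "100 \<le> x"
  shows "C1 \<phi> \<eta> \<alpha> * ln x + C2 \<phi> \<epsilon> \<eta> \<alpha> \<le> x"
proof (cases "C2 \<phi> \<epsilon> \<eta> \<alpha> > 0")
  case True
  then show ?thesis using cov n by (intro threshold_pos c1) (auto simp: N_fun_def Let_def)
next
  case False
  then show ?thesis using n by (intro threshold_nonpos c1) (auto simp: N_fun_def Let_def)
qed

text \<open>After taking logarithms, the terms of \<open>thr\<close> are what separates the bound on
  \<open>b\<close> from that on \<open>g\<close>. Of the entropy gap \<eta> H the rounding consumes
  \<alpha> \<eta> H, and (1 - \<alpha>) \<eta> H times x pays for the rest.\<close>

lemma concentration_estimate:
  fixes m \<mu> \<epsilon> \<eta> \<alpha> H x Hf b g :: real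
  assumes pos: "0 < \<mu>" "0 < \<epsilon>" "1 \<le> x" "1 \<le> m"
    and thr: "(0.5 * (m + \<mu>) - 1) * ln x
        + (m * ln 0.6 + (0.5 * ln (2 * pi) + 1 / 12 - 0.5 * ln \<mu>) * \<mu> + ln ((1 / \<epsilon> + 1) / 0.249))
      \<le> (1 - \<alpha>) * \<eta> * H * x"
    and Hf: "H - \<alpha> * \<eta> * H \<le> Hf"
    and b: "b \<le> exp (x * ((1 - \<eta>) * H)) * (9.8 * exp (m * ln 0.6) * exp ((m - 1) / 2 * ln x))"
    and g: "x * Hf + ln (2 * pi * x) / 2 - \<mu> / 2 * (ln (2 * pi) + ln x - ln \<mu>) - \<mu> / 12 \<le> ln g" "0 < g"
  shows "b * (1 / \<epsilon> + 1) \<le> g"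
proof -
  have e: "1 / \<epsilon> + 1 > 0" using pos by (simp add: add_pos_pos)
  have "b * (1 / \<epsilon> + 1) \<le> exp (x * ((1 - \<eta>) * H)) * (9.8 * exp (m * ln 0.6) * exp ((m - 1) / 2 * ln x)) * (1 / \<epsilon> + 1)"
    using b e by (intro mult_right_mono) auto
  also have "\<dots> = exp (x * ((1 - \<eta>) * H) + ln 9.8 + m * ln 0.6 + (m - 1) / 2 * ln x + ln (1 / \<epsilon> + 1))"
    using e by (simp add: exp_add)
  also have "\<dots> \<le> exp (ln g)"
    unfolding exp_le_cancel_iff
  proof -
    define E where "E = x * ((1 - \<eta>) * H)"
    have f1: "ln ((1 / \<epsilon> + 1) / 0.249) = ln (1 / \<epsilon> + 1) - ln 0.249" using e by (subst ln_div) auto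
    have f2: "ln (2 * pi * x) = ln (2 * pi) + ln x" using pos by (subst ln_mult) auto
    have "x * (H - \<alpha> * \<eta> * H) \<le> x * Hf" using Hf pos by (intro mult_left_mono) auto
    moreover have "x * (H - \<alpha> * \<eta> * H) = E + (1 - \<alpha>) * \<eta> * H * x"
      by (simp add: algebra_simps E_def)
    ultimately have f3: "E + (1 - \<alpha>) * \<eta> * H * x \<le> x * Hf" by simp
    have e1: "(0.5 * (m + \<mu>) - 1) * ln x = (m * ln x) / 2 + (\<mu> * ln x) / 2 - ln x"
      by (simp add: field_simps)
    have e2: "(m - 1) / 2 * ln x = (m * ln x) / 2 - ln x / 2"
      by (simp add: field_simps)
    have e3: "(0.5 * ln (2 * pi) + 1 / 12 - 0.5 * ln \<mu>) * \<mu> = (\<mu> * ln (2 * pi)) / 2 + \<mu> / 12 - (\<mu> * ln \<mu>) / 2"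
      by (simp add: field_simps)
    have e4: "\<mu> / 2 * (ln (2 * pi) + ln x - ln \<mu>) = (\<mu> * ln (2 * pi)) / 2 + (\<mu> * ln x) / 2 - (\<mu> * ln \<mu>) / 2"
      by (simp add: field_simps)
    show "x * ((1 - \<eta>) * H) + ln 9.8 + m * ln 0.6 + (m - 1) / 2 * ln x + ln (1 / \<epsilon> + 1) \<le> ln g"
      using thr[unfolded e1 e3 f1] g(1)[unfolded e4 f2] f3 ln_constants_le
      unfolding e2 E_def[symmetric] by argo
  qed
  also have "\<dots> = g" using g by simp
  finally show ?thesis .
qed


section \<open>The concentration theorem\<close>

theorem theorem3p1:
  fixes K :: "('m::finite) constraints" and \<delta> :: tolerances
    and \<phi> :: "real^'m" and \<epsilon> \<eta> \<alpha> :: real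
  assumes "wf_constraints K"
    and "is_arg_max entropy (\<lambda>x. x \<in> polytope_of K) \<phi>"
    and "entropy \<phi> > 0"
    and "pos_tolerances \<delta>" and "\<epsilon> > 0" and "\<eta> > 0"
    and "0 < \<alpha>" and "\<alpha> < 1"
    and "\<not> (C2 \<phi> \<epsilon> \<eta> \<alpha> > 0 \<and> C1 \<phi> \<eta> \<alpha> + C2 \<phi> \<epsilon> \<eta> \<alpha> < 21)"
    and "ereal (N_fun \<phi> \<epsilon> \<eta> \<alpha>) =
           ereal (real CARD('m) - 1) / (ereal (kappa \<phi>) * theta_0 K \<delta> \<phi> \<eta> \<alpha>)"
  shows "(\<alpha> * \<eta> * entropy \<phi> < real CARD('m) \<longrightarrow>
            ereal (N_fun \<phi> \<epsilon> \<eta> \<alpha>) = N_bound K \<delta> \<phi> \<eta> \<alpha>) \<and>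
         (\<forall>n::nat. ereal (real n) \<ge> N_bound K \<delta> \<phi> \<eta> \<alpha> \<and> n \<ge> 100 \<longrightarrow>
            num_realizations_set n
              {f \<in> freqs n \<inter> relaxed K \<delta>. entropy f \<ge> (1 - \<eta>) * entropy \<phi>}
            / num_realizations_set n (freqs n \<inter> relaxed K \<delta>) \<ge> 1 - \<epsilon>)"
proof -
  define m where "m = real CARD('m)"
  define \<mu> where "\<mu> = real (num_nonzero \<phi>)"
  define t where "t = \<alpha> * \<eta> * entropy \<phi>"
  define c0 where "c0 = (m - 1) / kappa \<phi>"
  define \<theta> where "\<theta> = theta_inf K \<delta>"
  have \<phi>: "\<phi> \<in> polytope_of K" using assms(2) by (simp add: is_arg_max_def)
  then have simplex: "\<phi> \<in> prob_simplex" by (simp add: polytope_of_def)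
  have supp: "2 \<le> num_nonzero \<phi>" by (rule two_le_num_nonzero[OF simplex assms(3)])
  have \<mu>m: "num_nonzero \<phi> \<le> CARD('m)" unfolding num_nonzero_def by (intro card_mono) auto
  have m: "2 \<le> m" and \<mu>: "2 \<le> \<mu>" "\<mu> \<le> m" using supp \<mu>m by (auto simp: m_def \<mu>_def)
  have kappa: "kappa \<phi> > 0" by (simp add: kappa_def)
  have c0: "0 < c0" using m kappa by (simp add: c0_def)
  have t: "0 < t" using assms by (simp add: t_def)
  have \<theta>: "0 < \<theta>" unfolding \<theta>_def by (rule theta_inf_pos[OF assms(1,4)])
  have nonneg: "0 \<le> \<phi> $ i" for i using simplex by (simp add: prob_simplex_def)
  have fin: "finite {\<phi> $ i | i. \<phi> $ i \<noteq> 0}" by simp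
  moreover have "{\<phi> $ i | i. \<phi> $ i \<noteq> 0} \<noteq> {}"
    using supp by (auto simp: num_nonzero_def card_le_Suc_iff numeral_2_eq_2)
  ultimately have min: "0 < min_nonzero \<phi>"
    unfolding min_nonzero_def using nonneg by (subst Min_gr_iff) (auto simp: less_le)
  have "2 * \<alpha> * \<eta> * entropy \<phi> = 2 * t" by (simp add: t_def)
  then have bound: "N_bound K \<delta> \<phi> \<eta> \<alpha>
      = ereal c0 * Max {ereal (3 * ln (m / t) / (2 * t)), 1 / \<theta>, 1 / ereal (min_nonzero \<phi>)}"
    unfolding N_bound_def by (simp only: c0_def \<theta>_def m_def t_def)
  \<comment> \<open>The condition t < m makes ln (m / t) positive, as the reciprocal of the middle
    term of \<open>theta_0\<close> requires.\<close>
  have part1: "ereal (N_fun \<phi> \<epsilon> \<eta> \<alpha>) = N_bound K \<delta> \<phi> \<eta> \<alpha>" if lt: "t < m"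
  proof -
    define l where "l = ln (m / t)"
    have l: "0 < l" using lt t by (simp add: l_def)
    have "theta_0 K \<delta> \<phi> \<eta> \<alpha> = Min {\<theta>, ereal (2 / 3 * (t / l)), ereal (min_nonzero \<phi>)}"
      using l by (simp add: theta_0_def \<theta>_def flip: t_def m_def l_def)
    moreover have "3 * ln (m / t) / (2 * t) = 1 / (2 / 3 * (t / l))" by (simp add: l_def)
    ultimately show ?thesis
      unfolding assms(10) bound c0_def
      using threshold_reciprocal[OF \<theta> _ min kappa, of "2 / 3 * (t / l)" "m - 1"] l t m
      by (simp only: m_def) simp
  qed
  have main: "1 - \<epsilon> \<le> num_realizations_set n {f \<in> freqs n \<inter> relaxed K \<delta>. entropy f \<ge> (1 - \<eta>) * entropy \<phi>}
            / num_realizations_set n (freqs n \<inter> relaxed K \<delta>)"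
    if n: "N_bound K \<delta> \<phi> \<eta> \<alpha> \<le> ereal (real n)" "100 \<le> n" for n
  proof -
    have n0: "0 < real n" "n > 0" using n by simp_all
    \<comment> \<open>Each term of the maximum has its own task: the first limits the entropy loss,
      1 / \<theta> keeps the rounded vector within the tolerances, and the last one preserves the
      support.\<close>
    have each: "ereal c0 * e \<le> ereal (real n)"
      if "e \<in> {ereal (3 * ln (m / t) / (2 * t)), 1 / \<theta>, 1 / ereal (min_nonzero \<phi>)}" for e
    proof -
      have "ereal c0 * e \<le> ereal c0 * Max {ereal (3 * ln (m / t) / (2 * t)), 1 / \<theta>, 1 / ereal (min_nonzero \<phi>)}"
        using that c0 by (intro ereal_mult_left_mono Max_ge) auto
      also have "\<dots> = N_bound K \<delta> \<phi> \<eta> \<alpha>"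
        by (rule bound[symmetric])
      finally show ?thesis using n by simp
    qed
    have "ereal c0 * ereal (3 * ln (m / t) / (2 * t)) \<le> ereal (real n)" by (rule each) simp
    then have n1: "c0 * (3 * ln (m / t) / (2 * t)) \<le> real n" by simp
    have "ereal c0 * (1 / ereal (min_nonzero \<phi>)) \<le> ereal (real n)" by (rule each) simp
    then have n2: "c0 \<le> real n * min_nonzero \<phi>" using min by (simp add: pos_divide_le_eq one_ereal_def)
    have n3: "ereal (c0 / real n) \<le> theta_inf K \<delta>"
    proof (cases "\<theta>")
      case (real r)
      have "ereal c0 * (1 / \<theta>) \<le> ereal (real n)" by (rule each) simp
      then show ?thesis using real \<theta> n0 by (simp add: \<theta>_def[symmetric] field_simps one_ereal_def)
    qed (use \<theta> in \<open>simp_all add: \<theta>_def\<close>)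
    obtain k :: "'m \<Rightarrow> nat" where k: "k \<in> comps UNIV n" "{i. k i \<noteq> 0} = {i. \<phi> $ i \<noteq> 0}"
      "\<And>i. \<bar>freq_of n k $ i - \<phi> $ i\<bar> \<le> c0 / real n"
      "entropy \<phi> - entropy (freq_of n k) \<le> real (num_nonzero \<phi>) / (4 * real n) * ln (4 * real n)"
      using support_rounding[of \<phi> n] simplex supp n(2) n2 unfolding c0_def m_def by auto
    define f where "f = freq_of n k"
    define S where "S = freqs n \<inter> relaxed K \<delta>"
    define good where "good = {f \<in> S. entropy f \<ge> (1 - \<eta>) * entropy \<phi>}"
    define bad where "bad = {f \<in> S. \<not> entropy f \<ge> (1 - \<eta>) * entropy \<phi>}"
    have finS: "finite S" unfolding S_def by (simp add: finite_freqs)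
    have S: "good \<union> bad = S" "good \<inter> bad = {}" "finite good" "finite bad"
      using finS by (auto simp: good_def bad_def)
    have "f \<in> S"
      using k relaxed_if_close[OF assms(1,4) \<phi> _ n3 k(3)] c0 n0 by (auto simp: S_def f_def freqs_eq)
    define g where "g = num_realizations_set n good"
    define b where "b = num_realizations_set n bad"
    have b0: "0 \<le> b" unfolding b_def num_realizations_set_def
      by (intro sum_nonneg less_imp_le[OF num_realizations_pos])
    have total: "num_realizations_set n S = g + b"
      unfolding g_def b_def num_realizations_set_def using S by (subst sum.union_disjoint[symmetric]) auto
    have fg: "num_realizations n f \<le> g" if "f \<in> good"
      unfolding g_def num_realizations_set_def using that S
      by (intro member_le_sum) (auto intro: less_imp_le[OF num_realizations_pos])
    have "0 < g \<and> b * (1 / \<epsilon> + 1) \<le> g"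
    proof (cases "\<eta> < 1")
      case False
      \<comment> \<open>For \<eta> >= 1 the entropy threshold is at most 0, so no vector is bad; the
        rounded vector still shows that the denominator is positive.\<close>
      have "0 \<le> entropy h" if "h \<in> S" for h
        using that freqs_subset_prob_simplex[OF n0(2)] by (intro entropy_nonneg) (auto simp: S_def)
      moreover have "(1 - \<eta>) * entropy \<phi> \<le> 0" using False assms(3) by (simp add: mult_nonpos_nonneg)
      ultimately have "bad = {}" and "f \<in> good"
        using \<open>f \<in> S\<close> unfolding good_def bad_def by force+
      then show ?thesis using fg num_realizations_pos[of n f] by (simp add: b_def num_realizations_set_def)
    next
      case True
      have H: "entropy \<phi> < m" unfolding m_def by (rule entropy_lt_card[OF simplex])
      have "\<alpha> * \<eta> \<le> 1 * 1" using assms True by (intro mult_mono) auto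
      then have "t \<le> 1 * entropy \<phi>" unfolding t_def using assms by (intro mult_right_mono) auto
      then have tm: "t < m" using H by simp
      \<comment> \<open>If \<mu> = m this reads m / 4 <= (m - 1) / 2, with equality for m = 2;
        otherwise m - 1 >= \<mu>.\<close>
      have "\<mu> / 4 \<le> c0" using \<mu> m \<mu>m by (auto simp: c0_def kappa_def m_def \<mu>_def)
      then have "\<mu> / (4 * real n) * ln (4 * real n) \<le> t"
        using n t tm \<mu> n1 by (intro entropy_tolerance_ge[of n t m \<mu> c0]) auto
      then have Hf: "entropy \<phi> - \<alpha> * \<eta> * entropy \<phi> \<le> entropy f"
        using k(4) by (simp add: f_def t_def \<mu>_def)
      have "t \<le> \<eta> * entropy \<phi>" using assms by (simp add: t_def)
      then have "f \<in> good" using Hf \<open>f \<in> S\<close> by (simp add: good_def t_def algebra_simps)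
      have gpos: "0 < g" using fg[OF \<open>f \<in> good\<close>] num_realizations_pos[of n f] by linarith
      define w where "w = (1 - \<alpha>) * \<eta> * entropy \<phi>"
      have w: "0 < w" using assms by (simp add: w_def)
      \<comment> \<open>The defining equation of \<alpha> enters here: the bound on n from the
        rounding is also the one that makes the rounded vector dominate.\<close>
      have "N_fun \<phi> \<epsilon> \<eta> \<alpha> \<le> real n" using part1[OF tm] n(1) by (metis ereal_less_eq(3))
      moreover have "0 < C1 \<phi> \<eta> \<alpha>" using w m \<mu> by (simp add: C1_def flip: w_def m_def \<mu>_def)
      ultimately have "C1 \<phi> \<eta> \<alpha> * ln (real n) + C2 \<phi> \<epsilon> \<eta> \<alpha> \<le> real n"
        using assms(9) n by (intro N_fun_le_imp) auto
      then have "w * (C1 \<phi> \<eta> \<alpha> * ln (real n) + C2 \<phi> \<epsilon> \<eta> \<alpha>) \<le> w * real n"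
        using w by (intro mult_left_mono) auto
      moreover have "w * C1 \<phi> \<eta> \<alpha> = 0.5 * (m + \<mu>) - 1"
        unfolding C1_def w_def[symmetric] m_def[symmetric] \<mu>_def[symmetric] using w by simp
      moreover have "w * C2 \<phi> \<epsilon> \<eta> \<alpha>
        = m * ln 0.6 + (0.5 * ln (2 * pi) + 1 / 12 - 0.5 * ln \<mu>) * \<mu> + ln ((1 / \<epsilon> + 1) / 0.249)"
        unfolding C2_def w_def[symmetric] m_def[symmetric] \<mu>_def[symmetric] using w by simp
      ultimately have thr: "(0.5 * (m + \<mu>) - 1) * ln (real n)
          + (m * ln 0.6 + (0.5 * ln (2 * pi) + 1 / 12 - 0.5 * ln \<mu>) * \<mu> + ln ((1 / \<epsilon> + 1) / 0.249))
          \<le> (1 - \<alpha>) * \<eta> * entropy \<phi> * real n"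
        by (simp only: distrib_left mult.assoc[symmetric] w_def)
      have "b \<le> exp (real n * ((1 - \<eta>) * entropy \<phi>)) * shtarkov n CARD('m)"
        unfolding b_def using n0 by (intro num_realizations_set_low_entropy_le) (auto simp: bad_def S_def)
      also have "\<dots> \<le> exp (real n * ((1 - \<eta>) * entropy \<phi>)) * (9.8 * 0.6 ^ CARD('m) * sqrt (real n) ^ (CARD('m) - 1))"
        using n by (intro mult_left_mono shtarkov_le) auto
      also have "(0.6 :: real) ^ CARD('m) = exp (m * ln 0.6)" by (simp add: m_def exp_of_nat_mult)
      also have "sqrt (real n) ^ (CARD('m) - 1) = exp ((m - 1) / 2 * ln (real n))"
      proof -
        have "(m - 1) / 2 * ln (real n) = real (CARD('m) - 1) * ln (sqrt (real n))"
          using n0 by (simp add: m_def ln_sqrt of_nat_diff)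
        then have "exp ((m - 1) / 2 * ln (real n)) = exp (ln (sqrt (real n))) ^ (CARD('m) - 1)"
          by (simp only: exp_of_nat_mult)
        then show ?thesis using n0 by simp
      qed
      finally have b: "b \<le> exp (real n * ((1 - \<eta>) * entropy \<phi>))
        * (9.8 * exp (m * ln 0.6) * exp ((m - 1) / 2 * ln (real n)))" .
      have "\<mu> = real (card {i. k i \<noteq> 0})" using k(2) by (simp add: \<mu>_def num_nonzero_def)
      then have "real n * entropy f + ln (2 * pi * real n) / 2
          - \<mu> / 2 * (ln (2 * pi) + ln (real n) - ln \<mu>) - \<mu> / 12 \<le> ln (num_realizations n f)"
        using ln_num_realizations_ge[OF _ k(1)] n0 unfolding f_def by simp
      also have "\<dots> \<le> ln g" using fg[OF \<open>f \<in> good\<close>] num_realizations_pos[of n f] by (intro ln_mono) auto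
      finally have "b * (1 / \<epsilon> + 1) \<le> g"
        using concentration_estimate[OF _ assms(5) _ _ thr Hf b _ gpos] \<mu> m n by simp
      then show ?thesis using gpos by simp
    qed
    then have "1 - \<epsilon> \<le> g / (g + b)" using b0 assms(5) by (intro ratio_ge) auto
    then show ?thesis using total by (simp add: g_def good_def S_def)
  qed
  show ?thesis using part1 main by (simp add: t_def m_def)
qed

end
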